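(* Let $K\subset\mathbb{R}^3$ be the regular octahedron with vertices $(\pm1,0,0)$, $(0,\pm1,0)$, $(0,0,\pm1)$ (of edge length $\sqrt2$ and volume $4/3$), and let $X,Y$ be independent random points uniformly distributed in $K$. Then $$\mathbb{E}\,\|X-Y\| = \frac{4}{105}+\frac{13 \sqrt{2}}{105}-\frac{4 \pi }{45}+\frac{109 \ln 3}{630 \sqrt{2}}+\frac{16\operatorname{arccot}\sqrt{2}}{315}+\frac{158\sqrt{2}\,\operatorname{arccoth}\sqrt{2}}{315}.$$ Consequently, for a regular octahedron of unit volume, the mean distance between two independent uniform random points equals $\sqrt[3]{3/4}$ times this number.
   Context: $\|\cdot\|$ is the Euclidean norm; "octahedron" means the solid body (convex hull of its vertices). For $x>0$, $\operatorname{arccot}x=\arctan(1/x)$; for $x>1$, $\operatorname{arccoth}x=\tfrac12\ln\frac{x+1}{x-1}$. *)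

theory Defs
  imports "HOL-Probability.Probability"
begin

text \<open>The following two formulas are the usual functions only for \<open>x > 0\<close> and \<open>x > 1\<close>, respectively.\<close>

definition arccot :: "real \<Rightarrow> real" where
  "arccot x = arctan (1 / x)"

definition arccoth :: "real \<Rightarrow> real" where
  "arccoth x = 1 / 2 * ln ((x + 1) / (x - 1))"

definition octahedron :: "(real ^ 3) set" where
  "octahedron = convex hull
     {vector [1, 0, 0], vector [- 1, 0, 0],
      vector [0, 1, 0], vector [0, - 1, 0],
      vector [0, 0, 1], vector [0, 0, - 1]}"

text \<open>The regular octahedra in space are the images of the standard one under similarities.\<close>

definition regular_octahedron :: "(real ^ 3) set \<Rightarrow> bool" where
  "regular_octahedron L \<longleftrightarrow>
     (\<exists>c s f. s > 0 \<and> orthogonal_transformation f \<and> L = (\<lambda>x. c + s *\<^sub>R f x) ` octahedron)"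

text \<open>Measurability of \<open>X\<close> and \<open>Y\<close> is part of \<^const>\<open>prob_space.indep_var\<close>.\<close>

definition independent_uniform_pair ::
    "'w measure \<Rightarrow> (real ^ 3) set \<Rightarrow> ('w \<Rightarrow> real ^ 3) \<Rightarrow> ('w \<Rightarrow> real ^ 3) \<Rightarrow> bool" where
  "independent_uniform_pair M L X Y \<longleftrightarrow>
     prob_space.indep_var M borel X borel Y \<and>
     distr M borel X = uniform_measure lborel L \<and>
     distr M borel Y = uniform_measure lborel L"

end

(* Let K be the octahedron |x1| + |x2| + |x3| <= 1. The mean distance is (3/4)^2 times the integral of
   |z| g(z), where g(z) = vol(K \<inter> (K + z)). Slices of K are squares, which become axis-parallel after a
   rotation by 45 degrees, so g(z) is a one-dimensional integral of a product of two overlap lengths.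
   On the octant z >= 0, g is a cubic polynomial plus correction terms in the three corners where one
   coordinate exceeds the sum of the others. Writing z = t p with p in the triangle a + b + c = 1, the
   integral over t leaves |p| times a polynomial. In the main part this polynomial is a function of |p|
   alone, and the corner terms are reduced to a single one by symmetry. The remaining double integral is
   elementary: first along c = const, then over c, which produces sqrt, ln, arctan and arsinh terms.

   The statement about unit volume follows since the double integral of |x - y| scales with
   the 7th power of the length. *)
theory Submission
  imports Defs
begin

section \<open>The octahedron and its edges\<close>

text \<open>The main part depends on \<open>|p|\<close> alone because \<open>2*(a*b + b*c + c*a) -
  (a^2 + b^2 + c^2) = (a + b + c)^2 - 2*|p|^2\<close>, and \<open>a + b + c = 1\<close> on the
  triangle. The corner terms break this: those in \<open>a\<close> and \<open>1 - a - c\<close>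
  would put kinks inside the inner integral. Symmetry trades them for copies of the term in
  \<open>c\<close>, which is constant along each line \<open>c = const\<close> and merely restricts
  the outer variable to \<open>c \<ge> 1/2\<close>. The endpoint 1/2 is the origin of
  \<open>ln 3\<close> and of \<open>arccot (sqrt 2)\<close> in the result. Signs decide the kind of
  integral. While the integrand is nonnegative, \<open>ennreal\<close>-valued integrals allow
  substitution and exchange under measurability alone, and the truncation of negative numbers by
  \<open>ennreal\<close> absorbs empty intersections. The symmetry argument splits the integrand
  into terms of varying sign, so there Bochner integrals and integrability are required.\<close>

lemma sum_abs_convex:
  "convex {x :: real^3. \<bar>x$1\<bar> + \<bar>x$2\<bar> + \<bar>x$3\<bar> \<le> 1}"
proof (rule convexI)
  fix x y :: "real^3" and u v :: real
  assume x: "x \<in> {x. \<bar>x$1\<bar> + \<bar>x$2\<bar> + \<bar>x$3\<bar> \<le> 1}" and y: "y \<in> {x. \<bar>x$1\<bar> + \<bar>x$2\<bar> + \<bar>x$3\<bar> \<le> 1}"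
    and uv: "0 \<le> u" "0 \<le> v" "u + v = 1"
  have b: "\<bar>u * s + v * t\<bar> \<le> u * \<bar>s\<bar> + v * \<bar>t\<bar>" for s t :: real
    using abs_triangle_ineq[of "u * s" "v * t"] uv by (simp add: abs_mult)
  have "u * (\<bar>x$1\<bar> + \<bar>x$2\<bar> + \<bar>x$3\<bar>) + v * (\<bar>y$1\<bar> + \<bar>y$2\<bar> + \<bar>y$3\<bar>) \<le> u * 1 + v * 1"
    using x y uv by (intro add_mono mult_left_mono) auto
  with b[of "x$1" "y$1"] b[of "x$2" "y$2"] b[of "x$3" "y$3"] uv
  show "u *\<^sub>R x + v *\<^sub>R y \<in> {x. \<bar>x$1\<bar> + \<bar>x$2\<bar> + \<bar>x$3\<bar> \<le> 1}"
    by (simp add: algebra_simps)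
qed

definition octa_vertices :: "(real ^ 3) set" where
  "octa_vertices = {vector [1, 0, 0], vector [- 1, 0, 0], vector [0, 1, 0],
     vector [0, - 1, 0], vector [0, 0, 1], vector [0, 0, - 1]}"

lemma octahedron_eq: "octahedron = {x. \<bar>x$1\<bar> + \<bar>x$2\<bar> + \<bar>x$3\<bar> \<le> 1}"
proof
  show "octahedron \<subseteq> {x. \<bar>x$1\<bar> + \<bar>x$2\<bar> + \<bar>x$3\<bar> \<le> 1}"
    unfolding octahedron_def by (intro hull_minimal sum_abs_convex) auto
  show "{x. \<bar>x$1\<bar> + \<bar>x$2\<bar> + \<bar>x$3\<bar> \<le> 1} \<subseteq> octahedron"
  proof
    fix x :: "real^3" assume "x \<in> {x. \<bar>x$1\<bar> + \<bar>x$2\<bar> + \<bar>x$3\<bar> \<le> 1}"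
    then have s: "\<bar>x$1\<bar> + \<bar>x$2\<bar> + \<bar>x$3\<bar> \<le> 1" by simp
    have K: "convex octahedron" unfolding octahedron_def by (rule convex_convex_hull)
    have v: "v \<in> octahedron" if "v \<in> octa_vertices" for v
      using hull_subset[of octa_vertices convex] that unfolding octahedron_def octa_vertices_def by blast
    \<comment> \<open>Three vertices on the side of \<open>x\<close>, weighted by its absolute
      coordinates; the remaining weight goes to the origin. As \<open>sgn 0 = 0\<close>, a vanishing
      coordinate also yields the origin instead of a vertex.\<close>
    define e :: "nat \<Rightarrow> real^3" where "e = (\<lambda>i.
      if i = 0 then vector [sgn (x$1), 0, 0] else if i = 1 then vector [0, sgn (x$2), 0]
      else if i = 2 then vector [0, 0, sgn (x$3)] else 0)"
    have vector_zero: "vector [0, 0, 0] = (0 :: real^3)" by (simp add: vec_eq_iff forall_3)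
    have "(0 :: real^3) = (1/2) *\<^sub>R vector [1,0,0] + (1/2) *\<^sub>R vector [-1,0,0]"
      by (simp add: vec_eq_iff forall_3)
    then have z: "0 \<in> octahedron"
      using convexD[OF K v v, of "vector [1,0,0]" "vector [-1,0,0]" "1/2" "1/2"]
      by (simp add: octa_vertices_def)
    have "{vector [0, 0, 0], vector [1, 0, 0], vector [- 1, 0, 0], vector [0, 1, 0],
        vector [0, - 1, 0], vector [0, 0, 1], vector [0, 0, - 1]} \<subseteq> octahedron"
      using z v by (auto simp: octa_vertices_def vector_zero)
    then have e: "e i \<in> octahedron" for i
      using z unfolding e_def by (auto simp: sgn_if)
    define a :: "nat \<Rightarrow> real" where "a = (\<lambda>i. if i = 0 then \<bar>x$1\<bar> else if i = 1 then \<bar>x$2\<bar> else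
       if i = 2 then \<bar>x$3\<bar> else 1 - \<bar>x$1\<bar> - \<bar>x$2\<bar> - \<bar>x$3\<bar>)"
    have "(\<Sum>i\<in>{..<4}. a i *\<^sub>R e i) \<in> octahedron"
      using s by (intro convex_sum K e) (auto simp: a_def eval_nat_numeral)
    moreover have "(\<Sum>i\<in>{..<4}. a i *\<^sub>R e i) = x"
      by (simp add: eval_nat_numeral a_def e_def vec_eq_iff forall_3 abs_mult_sgn)
    ultimately show "x \<in> octahedron" by simp
  qed
qed

lemma interior_octahedron: "{x. \<bar>x$1\<bar> + \<bar>x$2\<bar> + \<bar>x$3\<bar> < 1} \<subseteq> interior octahedron"
  unfolding octahedron_eq
  by (rule interior_maximal) (auto intro!: open_Collect_less continuous_intros)

text \<open>An edge is the segment between two vertices; it cannot join antipodal vertices because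
  the midpoint of these is interior.\<close>

lemma edge_of_octahedron:
  assumes "e edge_of octahedron"
  shows "\<exists>a b. e = closed_segment a b \<and> dist a b = sqrt 2"
proof -
  have f: "e face_of octahedron" and d: "aff_dim e = 1"
    using assms by (auto simp: edge_of_def)
  have K: "octahedron = convex hull octa_vertices" by (simp add: octahedron_def octa_vertices_def)
  have ck: "compact octahedron" unfolding K
    by (intro finite_imp_compact_convex_hull) (simp add: octa_vertices_def)
  have ce: "compact e" "convex e"
    using face_of_imp_compact[OF _ ck f] face_of_imp_convex[OF f] by (auto simp: K)
  have "e \<noteq> {}" "collinear e" using d by (auto simp: collinear_aff_dim)
  then obtain a b where ab: "e = closed_segment a b"
    using compact_convex_collinear_segment ce by blast
  have ne: "a \<noteq> b" using d ab by auto
  have "x \<in> octa_vertices" if "x \<in> {a,b}" for x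
  proof -
    have "x extreme_point_of e" using that ab by (auto simp: extreme_point_of_segment)
    then have "x extreme_point_of octahedron" using extreme_point_of_face[OF f] by blast
    then show ?thesis unfolding K by (rule extreme_point_of_convex_hull)
  qed
  then have V: "a \<in> octa_vertices" "b \<in> octa_vertices" by auto
  have "e \<noteq> octahedron"
  proof
    assume "e = octahedron"
    then have "interior e \<noteq> {}" using interior_octahedron by (auto dest: subsetD[of _ _ 0])
    then have "aff_dim e = DIM(real^3)" by (rule aff_dim_nonempty_interior)
    with d show False by simp
  qed
  then have "e \<inter> interior octahedron = {}"
    using face_of_disjoint_interior[OF f] by simp
  moreover have "0 \<in> interior octahedron" using interior_octahedron by auto
  moreover have "0 \<in> e" if "b = - a"
    using midpoint_in_closed_segment[of a b] that by (simp add: ab midpoint_def)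
  ultimately have "b \<noteq> - a" by auto
  \<comment> \<open>Vertices that are neither equal nor antipodal lie on different axes, so they
    differ by 1 in exactly two coordinates.\<close>
  with V ne have "dist a b = sqrt 2"
    unfolding octa_vertices_def
    by (auto simp: dist_norm norm_vec_def L2_set_def sum_3 vec_eq_iff forall_3)
  with ab show ?thesis by blast
qed

section \<open>Similarities and the covariogram\<close>

lemma vector_axis: "vector [a, b, c] = a *\<^sub>R axis 1 1 + b *\<^sub>R axis 2 1 + c *\<^sub>R (axis 3 1 :: real^3)"
  by (simp add: vec_eq_iff forall_3 axis_def)

lemma measurable_vector3 [measurable (raw)]:
  assumes [measurable]: "f \<in> borel_measurable M" "g \<in> borel_measurable M" "h \<in> borel_measurable M"
  shows "(\<lambda>x. vector [f x, g x, h x] :: real^3) \<in> borel_measurable M"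
  unfolding vector_axis by measurable

text \<open>Lebesgue measure is determined by its values on boxes, and a box in
  \<open>real^3\<close> pulls back to a product of three intervals.\<close>

lemma distr_vector_lborel:
  "lborel = distr (lborel \<Otimes>\<^sub>M lborel \<Otimes>\<^sub>M lborel) borel (\<lambda>(a, b, c). vector [a, b, c] :: real^3)"
proof (rule lborel_eqI)
  fix l u :: "real^3" assume lu: "\<And>b. b \<in> Basis \<Longrightarrow> l \<bullet> b \<le> u \<bullet> b"
  have le: "l $ i \<le> u $ i" for i
    using lu[of "axis i 1"] by (simp add: axis_in_Basis_iff inner_axis)
  show "emeasure (distr (lborel \<Otimes>\<^sub>M lborel \<Otimes>\<^sub>M lborel) borel (\<lambda>(a, b, c). vector [a, b, c])) (box l u) = (\<Prod>b\<in>Basis. (u - l) \<bullet> b)"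
  proof (subst emeasure_distr)
    have "(\<lambda>(a, b, c). vector [a, b, c]) -` box l u \<inter> space (lborel \<Otimes>\<^sub>M lborel \<Otimes>\<^sub>M lborel)
        = {l$1<..<u$1} \<times> {l$2<..<u$2} \<times> {l$3<..<u$3}"
      by (auto simp: mem_box_cart forall_3 space_pair_measure)
    moreover have "emeasure (lborel \<Otimes>\<^sub>M lborel \<Otimes>\<^sub>M lborel) ({l$1<..<u$1} \<times> {l$2<..<u$2} \<times> {l$3<..<u$3})
       = ennreal ((u$1-l$1) * ((u$2-l$2) * (u$3-l$3)))"
      using le by (simp add: lborel_pair.emeasure_pair_measure_Times lborel.emeasure_pair_measure_Times ennreal_mult)
    moreover have "(\<Prod>b\<in>Basis. (u - l) \<bullet> b) = (u$1-l$1) * ((u$2-l$2) * (u$3-l$3))"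
    proof -
      have B: "(Basis :: (real^3) set) = {axis 1 1, axis 2 1, axis 3 1}"
        unfolding Basis_vec_def Basis_real_def UNIV_3 by auto
      show ?thesis
        unfolding B by (simp add: axis_eq_axis inner_axis)
    qed
    ultimately show "emeasure (lborel \<Otimes>\<^sub>M lborel \<Otimes>\<^sub>M lborel) ((\<lambda>(a, b, c). vector [a, b, c]) -` box l u \<inter> space (lborel \<Otimes>\<^sub>M lborel \<Otimes>\<^sub>M lborel)) = (\<Prod>b\<in>Basis. (u - l) \<bullet> b)"
      by simp
  qed auto
qed simp

lemma nn_integral_vec3:
  fixes f :: "real^3 \<Rightarrow> ennreal"
  assumes [measurable]: "f \<in> borel_measurable borel"
  shows "(\<integral>\<^sup>+x. f x \<partial>lborel) = (\<integral>\<^sup>+a. \<integral>\<^sup>+b. \<integral>\<^sup>+c. f (vector [a, b, c]) \<partial>lborel \<partial>lborel \<partial>lborel)"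
proof -
  have P: "sigma_finite_measure (lborel \<Otimes>\<^sub>M lborel :: (real \<times> real) measure)"
    unfolding lborel_prod by (rule lborel.sigma_finite_measure_axioms)
  have "(\<integral>\<^sup>+x. f x \<partial>lborel) = (\<integral>\<^sup>+p. f (case p of (a, b, c) \<Rightarrow> vector [a, b, c]) \<partial>(lborel \<Otimes>\<^sub>M lborel \<Otimes>\<^sub>M lborel))"
    using nn_integral_distr[of "\<lambda>(a, b, c). vector [a, b, c]" "lborel \<Otimes>\<^sub>M lborel \<Otimes>\<^sub>M lborel" borel f]
    by (simp add: distr_vector_lborel[symmetric])
  also have "\<dots> = (\<integral>\<^sup>+a. \<integral>\<^sup>+q. f (case q of (b, c) \<Rightarrow> vector [a, b, c]) \<partial>(lborel \<Otimes>\<^sub>M lborel) \<partial>lborel)"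
    using sigma_finite_measure.nn_integral_fst[OF P, of "\<lambda>p. f (case p of (a, b, c) \<Rightarrow> vector [a, b, c])" lborel]
    by (simp add: split_beta')
  also have "\<dots> = (\<integral>\<^sup>+a. \<integral>\<^sup>+b. \<integral>\<^sup>+c. f (vector [a, b, c]) \<partial>lborel \<partial>lborel \<partial>lborel)"
  proof (rule nn_integral_cong)
    fix a :: real
    show "(\<integral>\<^sup>+q. f (case q of (b, c) \<Rightarrow> vector [a, b, c]) \<partial>(lborel \<Otimes>\<^sub>M lborel))
      = (\<integral>\<^sup>+b. \<integral>\<^sup>+c. f (vector [a, b, c]) \<partial>lborel \<partial>lborel)"
      using lborel.nn_integral_fst[of "\<lambda>q. f (case q of (b, c) \<Rightarrow> vector [a, b, c])" lborel]
      by simp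
  qed
  finally show ?thesis .
qed

section \<open>Similarities\<close>

lemma orthogonal_transformation_borel_measurable:
  fixes f :: "'a::euclidean_space \<Rightarrow> 'a"
  assumes "orthogonal_transformation f"
  shows "f \<in> borel_measurable borel"
  using assms by (intro borel_measurable_continuous_onI linear_continuous_on)
       (simp add: orthogonal_transformation_linear linear_linear)

text \<open>The preimage of a box is its image under the inverse, which is orthogonal too and so
  preserves Lebesgue measure.\<close>

lemma lborel_distr_orthogonal:
  fixes f :: "real^3 \<Rightarrow> real^3"
  assumes f: "orthogonal_transformation f"
  shows "distr lborel borel f = lborel"
proof (rule lborel_eqI[symmetric])
  note [measurable] = orthogonal_transformation_borel_measurable[OF f]
  have g: "orthogonal_transformation (inv f)" using f by (rule orthogonal_transformation_inv)
  fix l u :: "real^3" assume lu: "\<And>b. b \<in> Basis \<Longrightarrow> l \<bullet> b \<le> u \<bullet> b"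
  have "f -` box l u = inv f ` box l u"
    using f orthogonal_transformation_bij bij_vimage_eq_inv_image by blast
  then have "emeasure (distr lborel borel f) (box l u) = emeasure lborel (inv f ` box l u)"
    by (simp add: emeasure_distr)
  also have "inv f ` box l u \<in> sets borel"
    using \<open>f -` box l u = inv f ` box l u\<close> measurable_sets[of f borel borel "box l u"] by simp
  then have "emeasure lborel (inv f ` box l u) = emeasure lebesgue (inv f ` box l u)" by simp
  also have "\<dots> = ennreal (measure lebesgue (inv f ` box l u))"
    using measurable_orthogonal_image[OF g] by (intro emeasure_eq_measure2) auto
  also have "\<dots> = ennreal (measure lebesgue (box l u))"
    by (subst measure_orthogonal_image[OF g]) auto
  also have "\<dots> = (\<Prod>b\<in>Basis. (u - l) \<bullet> b)" using lu by (simp add: inner_diff_left)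
  finally show "emeasure (distr lborel borel f) (box l u) = (\<Prod>b\<in>Basis. (u - l) \<bullet> b)" .
qed simp

lemma nn_integral_lborel_affine:
  fixes h :: "'a::euclidean_space \<Rightarrow> ennreal"
  assumes [measurable]: "h \<in> borel_measurable borel" and "s \<noteq> 0"
  shows "(\<integral>\<^sup>+x. h x \<partial>lborel) = ennreal (\<bar>s\<bar> ^ DIM('a)) * (\<integral>\<^sup>+x. h (c + s *\<^sub>R x) \<partial>lborel)"
  by (subst lborel_affine[OF assms(2), of c])
     (simp add: nn_integral_density nn_integral_distr nn_integral_cmult)

lemma nn_integral_lborel_similarity:
  fixes h :: "real^3 \<Rightarrow> ennreal" and f :: "real^3 \<Rightarrow> real^3"
  assumes [measurable]: "h \<in> borel_measurable borel" and s: "s > 0" and f: "orthogonal_transformation f"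
  shows "(\<integral>\<^sup>+x. h x \<partial>lborel) = ennreal (s ^ 3) * (\<integral>\<^sup>+x. h (c + s *\<^sub>R f x) \<partial>lborel)"
proof -
  note [measurable] = orthogonal_transformation_borel_measurable[OF f]
  have "(\<integral>\<^sup>+x. h x \<partial>lborel) = ennreal (s ^ 3) * (\<integral>\<^sup>+x. h (c + s *\<^sub>R x) \<partial>lborel)"
    using s by (subst nn_integral_lborel_affine[of h s c]) auto
  also have "(\<integral>\<^sup>+x. h (c + s *\<^sub>R x) \<partial>lborel) = (\<integral>\<^sup>+x. h (c + s *\<^sub>R f x) \<partial>lborel)"
    by (subst lborel_distr_orthogonal[OF f, symmetric], subst nn_integral_distr) auto
  finally show ?thesis .
qed

definition dist_integral :: "(real^3) set \<Rightarrow> ennreal" where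
  "dist_integral S = (\<integral>\<^sup>+x. \<integral>\<^sup>+y. ennreal (norm (x - y)) * indicator S x * indicator S y \<partial>lborel \<partial>lborel)"

text \<open>Each integration variable contributes a factor \<open>s ^ 3\<close>, and the norm
  contributes one more \<open>s\<close>.\<close>

lemma
  fixes f :: "real^3 \<Rightarrow> real^3"
  assumes S [measurable]: "S \<in> sets borel" and s: "s > 0" and f: "orthogonal_transformation f"
    and L [measurable]: "L \<in> sets borel" and L_eq: "L = (\<lambda>x. c + s *\<^sub>R f x) ` S"
  shows emeasure_similarity: "emeasure lborel L = ennreal (s ^ 3) * emeasure lborel S"
    and dist_integral_similarity: "dist_integral L = ennreal (s ^ 7) * dist_integral S"
proof -
  note [measurable] = orthogonal_transformation_borel_measurable[OF f]
  have "inj f" using f orthogonal_transformation_inj by blast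
  then have ind: "indicator L (c + s *\<^sub>R f x) = (indicator S x :: ennreal)" for x
    using s by (auto simp: L_eq indicator_def inj_eq[OF \<open>inj f\<close>])
  have "(\<integral>\<^sup>+x. indicator L x \<partial>lborel) = ennreal (s ^ 3) * (\<integral>\<^sup>+x. indicator S x \<partial>lborel)"
    by (subst nn_integral_lborel_similarity[OF _ s f, of _ c]) (auto simp: ind)
  then show "emeasure lborel L = ennreal (s ^ 3) * emeasure lborel S" by simp
  have n: "norm (c + s *\<^sub>R f x - (c + s *\<^sub>R f y)) = s * norm (x - y)" for x y
  proof -
    have "c + s *\<^sub>R f x - (c + s *\<^sub>R f y) = s *\<^sub>R f (x - y)"
      by (simp add: linear_diff[OF orthogonal_transformation_linear[OF f]] scaleR_diff_right)
    then show ?thesis using s orthogonal_transformation_norm[OF f] by simp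
  qed
  have "dist_integral L = ennreal (s ^ 3) * (\<integral>\<^sup>+x. \<integral>\<^sup>+y.
      ennreal (norm (c + s *\<^sub>R f x - y)) * indicator L (c + s *\<^sub>R f x) * indicator L y \<partial>lborel \<partial>lborel)"
    unfolding dist_integral_def
    by (rule nn_integral_lborel_similarity[OF _ s f, where
        h = "\<lambda>x. \<integral>\<^sup>+y. ennreal (norm (x - y)) * indicator L x * indicator L y \<partial>lborel"]) measurable
  also have "\<dots> = ennreal (s ^ 3) * (\<integral>\<^sup>+x. ennreal (s ^ 3) * (\<integral>\<^sup>+y.
      ennreal s * (ennreal (norm (x - y)) * indicator S x * indicator S y) \<partial>lborel) \<partial>lborel)"
  proof -
    have "(\<integral>\<^sup>+y. ennreal (norm (c + s *\<^sub>R f x - y)) * indicator L (c + s *\<^sub>R f x) * indicator L y \<partial>lborel)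
      = ennreal (s ^ 3) * (\<integral>\<^sup>+y. ennreal (norm (c + s *\<^sub>R f x - (c + s *\<^sub>R f y)))
          * indicator L (c + s *\<^sub>R f x) * indicator L (c + s *\<^sub>R f y) \<partial>lborel)" for x
      by (rule nn_integral_lborel_similarity[OF _ s f, where
        h = "\<lambda>y. ennreal (norm (c + s *\<^sub>R f x - y)) * indicator L (c + s *\<^sub>R f x) * indicator L y"]) measurable
    then show ?thesis unfolding ind n using s by (simp add: ennreal_mult mult.assoc)
  qed
  also have "\<dots> = ennreal (s ^ 3) * (ennreal (s ^ 3) * (ennreal s * dist_integral S))"
    unfolding dist_integral_def by (simp add: nn_integral_cmult)
  also have "\<dots> = ennreal (s ^ 7) * dist_integral S"
    using s by (simp add: mult.assoc[symmetric] ennreal_mult[symmetric] power_add[symmetric] eval_nat_numeral)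
  finally show "dist_integral L = ennreal (s ^ 7) * dist_integral S" .
qed

section \<open>Covariogram and mean distance\<close>

definition covariogram :: "(real^3) set \<Rightarrow> real^3 \<Rightarrow> ennreal" where
  "covariogram S z = (\<integral>\<^sup>+x. indicator S x * indicator S (x - z) \<partial>lborel)"

text \<open>Substitute \<open>y = x - z\<close> and exchange the integrals.\<close>

lemma dist_integral_covariogram:
  assumes [measurable]: "S \<in> sets borel"
  shows "dist_integral S = (\<integral>\<^sup>+z. ennreal (norm z) * covariogram S z \<partial>lborel)"
proof -
  have "dist_integral S = (\<integral>\<^sup>+x. \<integral>\<^sup>+z. ennreal (norm z) * (indicator S x * indicator S (x - z)) \<partial>lborel \<partial>lborel)"
    unfolding dist_integral_def
  proof (rule nn_integral_cong)
    fix x :: "real^3"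
    show "(\<integral>\<^sup>+y. ennreal (norm (x - y)) * indicator S x * indicator S y \<partial>lborel)
      = (\<integral>\<^sup>+z. ennreal (norm z) * (indicator S x * indicator S (x - z)) \<partial>lborel)"
      by (subst nn_integral_lborel_affine[of _ "-1" x]) (auto simp: mult.assoc)
  qed
  also have "\<dots> = (\<integral>\<^sup>+z. \<integral>\<^sup>+x. ennreal (norm z) * (indicator S x * indicator S (x - z)) \<partial>lborel \<partial>lborel)"
    by (rule lborel_pair.Fubini') measurable
  finally show ?thesis by (simp add: covariogram_def nn_integral_cmult)
qed

text \<open>Independence makes the joint law the product of the two uniform laws, and each density
  contributes a factor 1 / volume.\<close>

lemma expectation_dist_uniform:
  assumes "prob_space M" and [measurable]: "L \<in> sets borel"
    and fin: "emeasure lborel L \<noteq> 0" "emeasure lborel L \<noteq> \<infinity>"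
    and XY: "independent_uniform_pair M L X Y"
  shows "prob_space.expectation M (\<lambda>w. norm (X w - Y w)) = enn2real (dist_integral L) / (measure lborel L)\<^sup>2"
proof -
  interpret prob_space M by fact
  let ?U = "uniform_measure lborel L"
  have rv [measurable]: "X \<in> borel_measurable M" "Y \<in> borel_measurable M"
    and d: "?U \<Otimes>\<^sub>M ?U = distr M (borel \<Otimes>\<^sub>M borel) (\<lambda>w. (X w, Y w))"
    using XY unfolding independent_uniform_pair_def indep_var_distribution_eq by auto
  interpret U: prob_space ?U
    using fin by (intro prob_space_uniform_measure) auto
  have "(\<integral>\<^sup>+w. ennreal (norm (X w - Y w)) \<partial>M) = (\<integral>\<^sup>+p. ennreal (norm (fst p - snd p)) \<partial>(?U \<Otimes>\<^sub>M ?U))"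
    unfolding d by (subst nn_integral_distr) auto
  also have "\<dots> = (\<integral>\<^sup>+x. \<integral>\<^sup>+y. ennreal (norm (x - y)) \<partial>?U \<partial>?U)"
    by (subst U.nn_integral_fst[symmetric]) auto
  also have "\<dots> = (\<integral>\<^sup>+x. (\<integral>\<^sup>+y. ennreal (norm (x - y)) * indicator L y \<partial>lborel) / emeasure lborel L * indicator L x \<partial>lborel) / emeasure lborel L"
    by (simp add: nn_integral_uniform_measure)
  also have "\<dots> = dist_integral L / emeasure lborel L / emeasure lborel L"
  proof -
    have "(\<integral>\<^sup>+y. ennreal (norm (x - y)) * indicator L y \<partial>lborel) / emeasure lborel L * indicator L x
      = (\<integral>\<^sup>+y. ennreal (norm (x - y)) * indicator L x * indicator L y \<partial>lborel) / emeasure lborel L" for x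
      by (auto split: split_indicator)
    then show ?thesis unfolding dist_integral_def by (simp add: nn_integral_divide)
  qed
  finally have "enn2real (\<integral>\<^sup>+w. ennreal (norm (X w - Y w)) \<partial>M) = enn2real (dist_integral L / emeasure lborel L / emeasure lborel L)"
    by simp
  moreover have e: "emeasure lborel L = ennreal (measure lborel L)"
    using fin by (intro emeasure_eq_ennreal_measure) auto
  moreover have "measure lborel L > 0"
    using e fin measure_nonneg[of lborel L] by (auto simp: less_le)
  \<comment> \<open>No integrability is required: a divergent expectation and
    \<open>enn2real \<infinity>\<close> are both 0.\<close>
  ultimately show ?thesis
    by (subst integral_eq_nn_integral)
       (simp_all add: divide_ennreal_def inverse_ennreal enn2real_mult power2_eq_square divide_inverse mult.assoc)
qed

section \<open>The covariogram of the octahedron\<close>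

lemma octahedron_borel [measurable]: "octahedron \<in> sets borel"
proof -
  have "closed octahedron" unfolding octahedron_eq
    by (intro closed_Collect_le continuous_intros)
  then show ?thesis by simp
qed

text \<open>\<open>\<bar>x\<bar> + \<bar>y\<bar>\<close> is the larger of
  \<open>\<bar>x + y\<bar>\<close> and \<open>\<bar>x - y\<bar>\<close>, so the indicator of a slice
  factorizes in these coordinates.\<close>

lemma indicator_octahedron:
  "indicator octahedron (vector [h, x, y]) = (indicator {z. \<bar>z\<bar> \<le> 1 - \<bar>h\<bar>} (x + y) * indicator {z. \<bar>z\<bar> \<le> 1 - \<bar>h\<bar>} (x - y) :: ennreal)"
  by (auto simp: octahedron_eq indicator_def)

text \<open>Two one-dimensional substitutions: \<open>m = x + y\<close> at fixed \<open>x\<close>,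
  then \<open>n = 2 * x - m\<close> at fixed \<open>m\<close>. The second one causes the factor
  1/2.\<close>

lemma nn_integral_rotate:
  fixes g :: "real \<Rightarrow> real \<Rightarrow> ennreal"
  assumes [measurable]: "case_prod g \<in> borel_measurable (borel \<Otimes>\<^sub>M borel)"
  shows "(\<integral>\<^sup>+x. \<integral>\<^sup>+y. g (x + y) (x - y) \<partial>lborel \<partial>lborel) = 1/2 * (\<integral>\<^sup>+m. \<integral>\<^sup>+n. g m n \<partial>lborel \<partial>lborel)"
proof -
  have "(\<integral>\<^sup>+x. \<integral>\<^sup>+y. g (x + y) (x - y) \<partial>lborel \<partial>lborel) = (\<integral>\<^sup>+x. \<integral>\<^sup>+m. g m (2 * x - m) \<partial>lborel \<partial>lborel)"
  proof (rule nn_integral_cong)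
    fix x :: real
    show "(\<integral>\<^sup>+y. g (x + y) (x - y) \<partial>lborel) = (\<integral>\<^sup>+m. g m (2 * x - m) \<partial>lborel)"
      by (subst nn_integral_real_affine[of _ 1 "- x"]) (auto simp: algebra_simps)
  qed
  also have "\<dots> = (\<integral>\<^sup>+m. \<integral>\<^sup>+x. g m (2 * x - m) \<partial>lborel \<partial>lborel)"
    by (rule lborel_pair.Fubini') measurable
  also have "\<dots> = (\<integral>\<^sup>+m. 1/2 * (\<integral>\<^sup>+n. g m n \<partial>lborel) \<partial>lborel)"
  proof (rule nn_integral_cong)
    fix m :: real
    have "(\<integral>\<^sup>+n. g m n \<partial>lborel) = 2 * (\<integral>\<^sup>+x. g m (2 * x - m) \<partial>lborel)"
      by (subst nn_integral_real_affine[of _ 2 "- m"]) (auto simp: algebra_simps)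
    then show "(\<integral>\<^sup>+x. g m (2 * x - m) \<partial>lborel) = 1/2 * (\<integral>\<^sup>+n. g m n \<partial>lborel)"
      by (simp add: mult.assoc[symmetric] ennreal_divide_times)
  qed
  also have "\<dots> = 1/2 * (\<integral>\<^sup>+m. \<integral>\<^sup>+n. g m n \<partial>lborel \<partial>lborel)"
    by (rule nn_integral_cmult) measurable
  finally show ?thesis .
qed

lemma nn_integral_even:
  fixes f :: "real \<Rightarrow> ennreal"
  assumes [measurable]: "f \<in> borel_measurable borel" and "\<And>x. f (- x) = f x"
  shows "(\<integral>\<^sup>+x. f x \<partial>lborel) = 2 * (\<integral>\<^sup>+x. f x * indicator {0..} x \<partial>lborel)"
proof -
  have "(\<integral>\<^sup>+x. f x \<partial>lborel) = (\<integral>\<^sup>+x. f x * indicator {0..} x + f x * indicator {..<0} x \<partial>lborel)"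
    by (intro nn_integral_cong) (auto split: split_indicator)
  also have "\<dots> = (\<integral>\<^sup>+x. f x * indicator {0..} x \<partial>lborel) + (\<integral>\<^sup>+x. f x * indicator {..<0} x \<partial>lborel)"
    by (rule nn_integral_add) measurable
  also have "(\<integral>\<^sup>+x. f x * indicator {..<0} x \<partial>lborel) = (\<integral>\<^sup>+x. f x * indicator {0<..} x \<partial>lborel)"
  proof -
    have "(\<integral>\<^sup>+x. f x * indicator {..<0} x \<partial>lborel) = (\<integral>\<^sup>+x. f (- x) * indicator {..<0} (- x) \<partial>lborel)"
      by (subst nn_integral_real_affine[of _ "-1" 0]) simp_all
    also have "\<dots> = (\<integral>\<^sup>+x. f x * indicator {0<..} x \<partial>lborel)"
      by (intro nn_integral_cong) (simp add: assms(2) indicator_def)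
    finally show ?thesis .
  qed
  also have "\<dots> = (\<integral>\<^sup>+x. f x * indicator {0..} x \<partial>lborel)"
    using AE_lborel_singleton[of "0::real"]
    by (intro nn_integral_cong_AE, eventually_elim) (auto split: split_indicator)
  finally show ?thesis by (simp add: mult_2)
qed

text \<open>The overlap of \<open>[- r, r]\<close> and \<open>[d - r', d + r']\<close>, where \<open>r = 1 - \<bar>h\<bar>\<close>, \<open>r' = 1 - \<bar>h - c\<bar>\<close>
  are the radii of two slices and \<open>u = \<bar>2 * h - c\<bar>\<close>.\<close>

definition overlap :: "real \<Rightarrow> real \<Rightarrow> real \<Rightarrow> real" where
  "overlap c d u = 2 - max (u + c) (max u c + d)"

lemma measurable_overlap [measurable]: "overlap c d \<in> borel_measurable borel"
  unfolding overlap_def[abs_def] by measurable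

text \<open>The overlap is the least of \<open>2 * r\<close>, \<open>2 * r'\<close> and
  \<open>r + r' - \<bar>d\<bar>\<close>. So it depends on \<open>h\<close> only through the sum and
  the maximum of \<open>\<bar>h\<bar>\<close> and \<open>\<bar>h - c\<bar>\<close>, and both are
  functions of \<open>\<bar>2 * h - c\<bar>\<close> and \<open>\<bar>c\<bar>\<close>.\<close>

lemma overlap_eq:
  "min (1 - \<bar>h\<bar>) (d + (1 - \<bar>h - c\<bar>)) - max (- (1 - \<bar>h\<bar>)) (d - (1 - \<bar>h - c\<bar>)) = overlap \<bar>c\<bar> \<bar>d\<bar> \<bar>2 * h - c\<bar>"
proof -
  have "\<bar>h\<bar> + \<bar>h - c\<bar> = max \<bar>2 * h - c\<bar> \<bar>c\<bar>" "2 * max \<bar>h\<bar> \<bar>h - c\<bar> = \<bar>2 * h - c\<bar> + \<bar>c\<bar>"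
    by (auto simp: abs_if max_def)
  then have "overlap \<bar>c\<bar> \<bar>d\<bar> \<bar>2 * h - c\<bar> = 2 - max (2 * max \<bar>h\<bar> \<bar>h - c\<bar>) (\<bar>h\<bar> + \<bar>h - c\<bar> + \<bar>d\<bar>)"
    by (simp add: overlap_def)
  also have "\<dots> = min (1 - \<bar>h\<bar>) (d + (1 - \<bar>h - c\<bar>)) - max (- (1 - \<bar>h\<bar>)) (d - (1 - \<bar>h - c\<bar>))"
    by (cases "d \<ge> 0") (auto simp: min_def max_def)
  finally show ?thesis by simp
qed

text \<open>For \<open>u < l\<close> both sides are 0, since \<open>ennreal\<close> truncates;
  disjoint slices thus need no separate case.\<close>

lemma emeasure_lborel_Icc_diff: "emeasure lborel {l..u} = ennreal (u - l)" for l u :: real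
  by (cases "l \<le> u") (auto simp: ennreal_neg)

lemma nn_integral_overlap:
  "(\<integral>\<^sup>+z. indicator {z. \<bar>z\<bar> \<le> 1 - \<bar>h\<bar>} z * indicator {z. \<bar>z\<bar> \<le> 1 - \<bar>h - c\<bar>} (z - d) \<partial>lborel)
    = ennreal (overlap \<bar>c\<bar> \<bar>d\<bar> \<bar>2 * h - c\<bar>)"
proof -
  let ?l = "max (- (1 - \<bar>h\<bar>)) (d - (1 - \<bar>h - c\<bar>))" and ?u = "min (1 - \<bar>h\<bar>) (d + (1 - \<bar>h - c\<bar>))"
  have "(\<integral>\<^sup>+z. indicator {z. \<bar>z\<bar> \<le> 1 - \<bar>h\<bar>} z * indicator {z. \<bar>z\<bar> \<le> 1 - \<bar>h - c\<bar>} (z - d) \<partial>lborel)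
    = (\<integral>\<^sup>+z. indicator {?l..?u} z \<partial>lborel)"
    by (intro nn_integral_cong) (auto split: split_indicator)
  also have "\<dots> = emeasure lborel {?l..?u}"
    by (rule nn_integral_indicator) simp
  also have "\<dots> = ennreal (?u - ?l)"
    by (rule emeasure_lborel_Icc_diff)
  finally show ?thesis by (simp only: overlap_eq)
qed

text \<open>The slices at height \<open>h\<close> of the body and of its translate are intersected;
  the factor 1/2 is the Jacobian of \<open>nn_integral_rotate\<close>.\<close>

lemma covariogram_octahedron:
  "covariogram octahedron (vector [c, a, b]) =
    1/2 * (\<integral>\<^sup>+u. ennreal (overlap \<bar>c\<bar> \<bar>a + b\<bar> u) * ennreal (overlap \<bar>c\<bar> \<bar>a - b\<bar> u) * indicator {0..} u \<partial>lborel)"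
proof -
  define I :: "real \<Rightarrow> real \<Rightarrow> ennreal" where "I = (\<lambda>r. indicator {z. \<bar>z\<bar> \<le> r})"
  have [measurable]: "I r \<in> borel_measurable borel" for r
    unfolding I_def by measurable
  have diff: "vector [h, x, y] - vector [c, a, b] = (vector [h - c, x - a, y - b] :: real^3)" for h x y
    by (simp add: vec_eq_iff forall_3)
  have ind: "indicator octahedron (vector [h, x, y]) * indicator octahedron (vector [h, x, y] - vector [c, a, b])
    = (I (1 - \<bar>h\<bar>) (x + y) * I (1 - \<bar>h - c\<bar>) (x + y - (a + b)))
      * (I (1 - \<bar>h\<bar>) (x - y) * I (1 - \<bar>h - c\<bar>) (x - y - (a - b)))" for h x y
  proof -
    have "x - a + (y - b) = x + y - (a + b)" "x - a - (y - b) = x - y - (a - b)" by simp_all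
    then show ?thesis unfolding diff indicator_octahedron I_def by (simp only: mult_ac)
  qed
  have "covariogram octahedron (vector [c, a, b]) = (\<integral>\<^sup>+h. \<integral>\<^sup>+x. \<integral>\<^sup>+y.
      indicator octahedron (vector [h, x, y]) * indicator octahedron (vector [h, x, y] - vector [c, a, b]) \<partial>lborel \<partial>lborel \<partial>lborel)"
    unfolding covariogram_def
    by (rule nn_integral_vec3[of "\<lambda>x. indicator octahedron x * indicator octahedron (x - vector [c, a, b])"]) measurable
  also have "\<dots> = (\<integral>\<^sup>+h. \<integral>\<^sup>+x. \<integral>\<^sup>+y. (I (1 - \<bar>h\<bar>) (x + y) * I (1 - \<bar>h - c\<bar>) (x + y - (a + b)))
      * (I (1 - \<bar>h\<bar>) (x - y) * I (1 - \<bar>h - c\<bar>) (x - y - (a - b))) \<partial>lborel \<partial>lborel \<partial>lborel)"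
    unfolding ind ..
  also have "\<dots> = (\<integral>\<^sup>+h. 1/2 * (ennreal (overlap \<bar>c\<bar> \<bar>a + b\<bar> \<bar>2 * h - c\<bar>) * ennreal (overlap \<bar>c\<bar> \<bar>a - b\<bar> \<bar>2 * h - c\<bar>)) \<partial>lborel)"
  proof (rule nn_integral_cong)
    fix h :: real
    have "(\<integral>\<^sup>+x. \<integral>\<^sup>+y. (I (1 - \<bar>h\<bar>) (x + y) * I (1 - \<bar>h - c\<bar>) (x + y - (a + b)))
      * (I (1 - \<bar>h\<bar>) (x - y) * I (1 - \<bar>h - c\<bar>) (x - y - (a - b))) \<partial>lborel \<partial>lborel)
      = 1/2 * (\<integral>\<^sup>+m. \<integral>\<^sup>+n. (I (1 - \<bar>h\<bar>) m * I (1 - \<bar>h - c\<bar>) (m - (a + b)))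
      * (I (1 - \<bar>h\<bar>) n * I (1 - \<bar>h - c\<bar>) (n - (a - b))) \<partial>lborel \<partial>lborel)"
      by (rule nn_integral_rotate) measurable
    also have "\<dots> = 1/2 * (ennreal (overlap \<bar>c\<bar> \<bar>a + b\<bar> \<bar>2 * h - c\<bar>) * ennreal (overlap \<bar>c\<bar> \<bar>a - b\<bar> \<bar>2 * h - c\<bar>))"
    proof -
      have "(\<integral>\<^sup>+z. I (1 - \<bar>h\<bar>) z * I (1 - \<bar>h - c\<bar>) (z - d) \<partial>lborel) = ennreal (overlap \<bar>c\<bar> \<bar>d\<bar> \<bar>2 * h - c\<bar>)" for d
        unfolding I_def by (rule nn_integral_overlap)
      then show ?thesis by (simp add: nn_integral_cmult nn_integral_multc)
    qed
    finally show "(\<integral>\<^sup>+x. \<integral>\<^sup>+y. (I (1 - \<bar>h\<bar>) (x + y) * I (1 - \<bar>h - c\<bar>) (x + y - (a + b)))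
      * (I (1 - \<bar>h\<bar>) (x - y) * I (1 - \<bar>h - c\<bar>) (x - y - (a - b))) \<partial>lborel \<partial>lborel)
      = 1/2 * (ennreal (overlap \<bar>c\<bar> \<bar>a + b\<bar> \<bar>2 * h - c\<bar>) * ennreal (overlap \<bar>c\<bar> \<bar>a - b\<bar> \<bar>2 * h - c\<bar>))" .
  qed
  also have "\<dots> = 1/2 * (\<integral>\<^sup>+h. ennreal (overlap \<bar>c\<bar> \<bar>a + b\<bar> \<bar>2 * h - c\<bar>) * ennreal (overlap \<bar>c\<bar> \<bar>a - b\<bar> \<bar>2 * h - c\<bar>) \<partial>lborel)"
    by (rule nn_integral_cmult) measurable
  also have "(\<integral>\<^sup>+h. ennreal (overlap \<bar>c\<bar> \<bar>a + b\<bar> \<bar>2 * h - c\<bar>) * ennreal (overlap \<bar>c\<bar> \<bar>a - b\<bar> \<bar>2 * h - c\<bar>) \<partial>lborel)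
    = (\<integral>\<^sup>+u. ennreal (overlap \<bar>c\<bar> \<bar>a + b\<bar> u) * ennreal (overlap \<bar>c\<bar> \<bar>a - b\<bar> u) * indicator {0..} u \<partial>lborel)"
    (is "?A = ?B")
  proof -
    let ?f = "\<lambda>u. ennreal (overlap \<bar>c\<bar> \<bar>a + b\<bar> \<bar>u\<bar>) * ennreal (overlap \<bar>c\<bar> \<bar>a - b\<bar> \<bar>u\<bar>)"
    \<comment> \<open>The factor 2 from \<open>u = 2 * h - c\<close> cancels against the 2 from
      folding the even integrand onto \<open>u \<ge> 0\<close>.\<close>
    have "2 * ?A = (\<integral>\<^sup>+u. ?f u \<partial>lborel)"
      by (subst nn_integral_real_affine[of ?f 2 "- c"]) (auto simp: algebra_simps)
    also have "\<dots> = 2 * (\<integral>\<^sup>+u. ?f u * indicator {0..} u \<partial>lborel)"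
      by (rule nn_integral_even) auto
    also have "(\<integral>\<^sup>+u. ?f u * indicator {0..} u \<partial>lborel) = ?B"
      by (intro nn_integral_cong) (auto split: split_indicator)
    finally show ?thesis by (simp add: ennreal_mult_cancel_left)
  qed
  finally show ?thesis .
qed

text \<open>If the signs of \<open>a\<close> and \<open>b\<close> differ,
  \<open>\<bar>a + b\<bar>\<close> and \<open>\<bar>a - b\<bar>\<close> trade places, and they enter
  symmetrically.\<close>

lemma covariogram_octahedron_abs:
  "covariogram octahedron (vector [c, a, b]) = covariogram octahedron (vector [\<bar>c\<bar>, \<bar>a\<bar>, \<bar>b\<bar>])"
proof (cases "(a \<ge> 0) = (b \<ge> 0)")
  case True
  then have "\<bar>a + b\<bar> = \<bar>\<bar>a\<bar> + \<bar>b\<bar>\<bar>" "\<bar>a - b\<bar> = \<bar>\<bar>a\<bar> - \<bar>b\<bar>\<bar>" by linarith+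
  then show ?thesis unfolding covariogram_octahedron by simp
next
  case False
  then have "\<bar>a + b\<bar> = \<bar>\<bar>a\<bar> - \<bar>b\<bar>\<bar>" "\<bar>a - b\<bar> = \<bar>\<bar>a\<bar> + \<bar>b\<bar>\<bar>" by linarith+
  then show ?thesis unfolding covariogram_octahedron by (simp add: mult.commute)
qed

text \<open>Lets the volume of the octahedron be read off from the closed form of its
  covariogram.\<close>

lemma emeasure_covariogram:
  assumes [measurable]: "S \<in> sets borel"
  shows "emeasure lborel S = covariogram S 0"
proof -
  have "covariogram S 0 = (\<integral>\<^sup>+x. indicator S x \<partial>lborel)"
    unfolding covariogram_def by (intro nn_integral_cong) (auto split: split_indicator)
  then show ?thesis by simp
qed

text \<open>The volume of \<open>K \<inter> (K + z)\<close> for the octahedron \<open>K\<close> and \<open>z = (c, a, b)\<close> with nonnegative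
  coordinates and \<open>a + b + c \<le> 2\<close>.\<close>

definition octa_poly :: "real \<Rightarrow> real \<Rightarrow> real \<Rightarrow> real" where
  "octa_poly c a b = (let s = 2 - a - b - c; e = \<lambda>x. max 0 (2 * x - (a + b + c)) in
     s * (s / 2 - s\<^sup>2 / 12 + (2 * (a * b + b * c + c * a) - (a\<^sup>2 + b\<^sup>2 + c\<^sup>2)) / 4)
     + s * e a * (e a - s) / 4 + s * e b * (e b - s) / 4 + s * e c * (e c - s) / 4)"

text \<open>Made for the pieces of a piecewise polynomial \<open>f\<close>: it only has to agree
  with the smooth \<open>g\<close> on the given interval.\<close>

lemma has_integral_FTC_eq:
  fixes f g F :: "real \<Rightarrow> real"
  assumes "p \<le> q" and "\<And>x. (F has_real_derivative g x) (at x)"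
    and "\<And>x. p \<le> x \<Longrightarrow> x \<le> q \<Longrightarrow> f x = g x"
  shows "(f has_integral (F q - F p)) {p..q}"
proof -
  have "(g has_integral (F q - F p)) {p..q}"
    using assms by (intro fundamental_theorem_of_calculus)
      (auto simp: has_real_derivative_iff_has_vector_derivative[symmetric] intro: has_field_derivative_at_within)
  then show ?thesis by (rule has_integral_eq[rotated]) (use assms(3) in auto)
qed


text \<open>If \<open>d \<le> c\<close>, then \<open>overlap c d\<close> is constant up to
  \<open>u = d\<close> and equals \<open>2 - c - u\<close> from there on; otherwise it is constant
  up to \<open>u = c\<close> and then equals \<open>2 - d - u\<close>. The position of
  \<open>c\<close> relative to \<open>n\<close> and \<open>m\<close> therefore gives the three
  cases. The range ends where the smaller factor \<open>overlap c m u\<close> reaches 0.\<close>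

lemma overlap_integral:
  assumes "0 \<le> c" "0 \<le> n" "n \<le> m" "c + m \<le> 2"
  defines "s \<equiv> 2 - c - m"
  shows "((\<lambda>u. overlap c m u * overlap c n u) has_integral
     (if m \<le> c then s * (m\<^sup>2 / 2 + s * m - n\<^sup>2 / 2 + s\<^sup>2 / 3)
      else if n \<le> c then s * (2 * c - 3/2 * c\<^sup>2 - n\<^sup>2 / 2) + s\<^sup>2 * (m - c) / 2 + s ^ 3 / 3
      else s * c * (2 - c - n) + s\<^sup>2 * (m - n) / 2 + s ^ 3 / 3)) {0..2 - max c m}"
proof (cases "m \<le> c")
  case True
  have 1: "((\<lambda>u. overlap c m u * overlap c n u) has_integral
      (2 - c - m) * (2 - c - n) * n - (2 - c - m) * (2 - c - n) * 0) {0..n}"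
    by (rule has_integral_FTC_eq[where g = "\<lambda>u. (2 - c - m) * (2 - c - n)"])
       (use assms True in \<open>auto intro!: derivative_eq_intros simp: overlap_def max_def algebra_simps add_divide_distrib diff_divide_distrib\<close>)
  have 2: "((\<lambda>u. overlap c m u * overlap c n u) has_integral
      (2 - c - m) * ((2 - c) * m - m\<^sup>2 / 2) - (2 - c - m) * ((2 - c) * n - n\<^sup>2 / 2)) {n..m}"
    by (rule has_integral_FTC_eq[where g = "\<lambda>u. (2 - c - m) * (2 - c - u)"])
       (use assms True in \<open>auto intro!: derivative_eq_intros simp: overlap_def max_def algebra_simps add_divide_distrib diff_divide_distrib\<close>)
  have 3: "((\<lambda>u. overlap c m u * overlap c n u) has_integral
      (- ((2 - c - (2 - c)) ^ 3) / 3 - (- ((2 - c - m) ^ 3) / 3))) {m..2 - c}"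
    by (rule has_integral_FTC_eq[where g = "\<lambda>u. (2 - c - u)\<^sup>2"])
       (use assms True in \<open>auto intro!: derivative_eq_intros simp: overlap_def max_def algebra_simps add_divide_distrib diff_divide_distrib power2_eq_square\<close>)
  have "max c m = c" "0 \<le> m" "m \<le> 2 - c" using assms True by auto
  with has_integral_combine[OF _ _ has_integral_combine[OF _ _ 1 2] 3] show ?thesis using assms True
    by (simp, elim has_integral_eq_rhs) (simp add: s_def field_simps power2_eq_square power3_eq_cube)
next
  case False
  show ?thesis
  proof (cases "n \<le> c")
    case True
    have 1: "((\<lambda>u. overlap c m u * overlap c n u) has_integral
        (2 - c - m) * (2 - c - n) * n - (2 - c - m) * (2 - c - n) * 0) {0..n}"
      by (rule has_integral_FTC_eq[where g = "\<lambda>u. (2 - c - m) * (2 - c - n)"])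
         (use assms True False in \<open>auto intro!: derivative_eq_intros simp: overlap_def max_def algebra_simps add_divide_distrib diff_divide_distrib\<close>)
    have 2: "((\<lambda>u. overlap c m u * overlap c n u) has_integral
        (2 - c - m) * ((2 - c) * c - c\<^sup>2 / 2) - (2 - c - m) * ((2 - c) * n - n\<^sup>2 / 2)) {n..c}"
      by (rule has_integral_FTC_eq[where g = "\<lambda>u. (2 - c - m) * (2 - c - u)"])
         (use assms True False in \<open>auto intro!: derivative_eq_intros simp: overlap_def max_def algebra_simps add_divide_distrib diff_divide_distrib\<close>)
    have 3: "((\<lambda>u. overlap c m u * overlap c n u) has_integral
        (- ((2 - m - (2 - m)) ^ 3) / 3 - (m - c) * (2 - m - (2 - m))\<^sup>2 / 2)
          - (- ((2 - m - c) ^ 3) / 3 - (m - c) * (2 - m - c)\<^sup>2 / 2)) {c..2 - m}"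
      by (rule has_integral_FTC_eq[where g = "\<lambda>u. (2 - m - u) * (2 - c - u)"])
         (use assms True False in \<open>auto intro!: derivative_eq_intros simp: overlap_def max_def algebra_simps add_divide_distrib diff_divide_distrib power2_eq_square\<close>)
    have "max c m = m" "c \<le> 2 - m" using assms False by auto
    with has_integral_combine[OF _ _ has_integral_combine[OF _ _ 1 2] 3] show ?thesis using assms True False
      by (simp, elim has_integral_eq_rhs) (simp add: s_def field_simps power2_eq_square power3_eq_cube)
  next
    case nc: False
    have 1: "((\<lambda>u. overlap c m u * overlap c n u) has_integral
        (2 - c - m) * (2 - c - n) * c - (2 - c - m) * (2 - c - n) * 0) {0..c}"
      by (rule has_integral_FTC_eq[where g = "\<lambda>u. (2 - c - m) * (2 - c - n)"])
         (use assms nc False in \<open>auto intro!: derivative_eq_intros simp: overlap_def max_def algebra_simps add_divide_distrib diff_divide_distrib\<close>)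
    have 3: "((\<lambda>u. overlap c m u * overlap c n u) has_integral
        (- ((2 - m - (2 - m)) ^ 3) / 3 - (m - n) * (2 - m - (2 - m))\<^sup>2 / 2)
          - (- ((2 - m - c) ^ 3) / 3 - (m - n) * (2 - m - c)\<^sup>2 / 2)) {c..2 - m}"
      by (rule has_integral_FTC_eq[where g = "\<lambda>u. (2 - m - u) * (2 - n - u)"])
         (use assms nc False in \<open>auto intro!: derivative_eq_intros simp: overlap_def max_def algebra_simps add_divide_distrib diff_divide_distrib power2_eq_square\<close>)
    have "max c m = m" "c \<le> 2 - m" using assms False by auto
    with has_integral_combine[OF _ _ 1 3] show ?thesis using assms nc False
      by (simp, elim has_integral_eq_rhs) (simp add: s_def field_simps power2_eq_square power3_eq_cube)
  qed
qed

section \<open>Elementary integrals\<close>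

text \<open>On the line \<open>c = const\<close> of the plane \<open>a + b + c = 1\<close>, \<open>a\<^sup>2 + b\<^sup>2 + c\<^sup>2\<close> equals
  \<open>(chord_quad c + (a - b)\<^sup>2) / 2\<close>, with the value \<open>edge_quad c\<close> at the ends \<open>a = 0\<close> and \<open>b = 0\<close>.\<close>

definition edge_quad :: "real \<Rightarrow> real" where "edge_quad c = 2 * c\<^sup>2 - 2 * c + 1"
definition chord_quad :: "real \<Rightarrow> real" where "chord_quad c = 3 * c\<^sup>2 - 2 * c + 1"
definition edge_norm :: "real \<Rightarrow> real" where "edge_norm c = sqrt (edge_quad c)"
definition edge_arsinh :: "real \<Rightarrow> real" where "edge_arsinh c = arsinh ((1 - c) / sqrt (chord_quad c))"

lemma edge_quad_pos: "edge_quad c > 0"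
proof -
  have "edge_quad c = c\<^sup>2 + (1 - c)\<^sup>2" by (simp add: edge_quad_def power2_eq_square algebra_simps)
  then show ?thesis by (cases "c = 0") (auto simp: add_pos_nonneg)
qed

lemma chord_quad_eq: "chord_quad c = c\<^sup>2 + edge_quad c"
  by (simp add: edge_quad_def chord_quad_def)

lemma chord_quad_pos: "chord_quad c > 0"
  using edge_quad_pos[of c] by (simp add: chord_quad_eq add_nonneg_pos)

lemma edge_norm_pos: "edge_norm c > 0" and edge_norm_power2: "(edge_norm c)\<^sup>2 = edge_quad c"
  using edge_quad_pos[of c] by (auto simp: edge_norm_def)

lemma DERIV_edge_norm: "(edge_norm has_real_derivative (2 * c - 1) / edge_norm c) (at c)"
  unfolding edge_norm_def[abs_def] edge_quad_def
  by (rule derivative_eq_intros refl | use edge_quad_pos[of c] in \<open>simp add: edge_quad_def field_simps\<close>)+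

lemma DERIV_arsinh_div_sqrt:
  assumes "D > 0"
  shows "((\<lambda>n. arsinh (n / sqrt D)) has_real_derivative 1 / sqrt (D + n\<^sup>2)) (at n)"
proof -
  have "sqrt D * sqrt ((n / sqrt D)\<^sup>2 + 1) = sqrt (D + n\<^sup>2)"
    using assms by (simp add: real_sqrt_mult[symmetric] power_divide field_simps)
  moreover have "((\<lambda>n. n / sqrt D) has_real_derivative 1 / sqrt D) (at n)"
    by (rule DERIV_cong[OF DERIV_cdivide[OF DERIV_ident]]) simp
  ultimately show ?thesis
    by (intro DERIV_cong[OF DERIV_chain2[OF arsinh_real_has_field_derivative]]) (auto simp: mult.commute)
qed

lemma DERIV_edge_arsinh: "(edge_arsinh has_real_derivative - (sqrt 2 * c) / (chord_quad c * edge_norm c)) (at c)"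
proof -
  have D: "chord_quad c > 0" by (rule chord_quad_pos)
  \<comment> \<open>Amounts to \<open>chord_quad c + (1 - c)^2 = 2 * edge_quad c\<close>.\<close>
  have "sqrt (chord_quad c) * sqrt (((1 - c) / sqrt (chord_quad c))\<^sup>2 + 1) = sqrt 2 * edge_norm c"
    using D unfolding real_sqrt_mult[symmetric] edge_norm_def
    by (simp add: power_divide field_simps) (simp add: chord_quad_def edge_quad_def power2_eq_square algebra_simps)
  then have s: "sqrt (((1 - c) / sqrt (chord_quad c))\<^sup>2 + 1) = sqrt 2 * edge_norm c / sqrt (chord_quad c)"
    using D by (simp add: field_simps)
  have "((\<lambda>c. (1 - c) / sqrt (chord_quad c)) has_real_derivative - 2 * c / (chord_quad c * sqrt (chord_quad c))) (at c)"
  proof -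
    have dD: "(chord_quad has_real_derivative 6 * c - 2) (at c)"
      unfolding chord_quad_def[abs_def] by (auto intro!: derivative_eq_intros)
    have "sqrt (chord_quad c) * sqrt (chord_quad c) = chord_quad c" using D by simp
    then show ?thesis
      using D by (auto intro!: derivative_eq_intros DERIV_chain2[OF _ dD] dD simp: field_simps)
        (simp add: chord_quad_def power2_eq_square algebra_simps)
  qed
  then have "(edge_arsinh has_real_derivative 1 / sqrt (((1 - c) / sqrt (chord_quad c))\<^sup>2 + 1) * (- 2 * c / (chord_quad c * sqrt (chord_quad c)))) (at c)"
    unfolding edge_arsinh_def[abs_def] by (rule DERIV_chain2[OF arsinh_real_has_field_derivative])
  moreover have "1 / sqrt (((1 - c) / sqrt (chord_quad c))\<^sup>2 + 1) * (- 2 * c / (chord_quad c * sqrt (chord_quad c))) = - (sqrt 2 * c) / (chord_quad c * edge_norm c)"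
    unfolding s using D edge_norm_pos[of c] by (simp add: field_simps)
  ultimately show ?thesis by simp
qed

lemma DERIV_arsinh_edge_norm: "((\<lambda>c. arsinh (2 * c - 1)) has_real_derivative sqrt 2 / edge_norm c) (at c)"
proof -
  have "sqrt ((2 * c - 1)\<^sup>2 + 1) = sqrt 2 * edge_norm c"
    unfolding edge_norm_def real_sqrt_mult[symmetric] by (simp add: edge_quad_def power2_eq_square algebra_simps)
  moreover have "((\<lambda>c. 2 * c - 1) has_real_derivative 2) (at c)"
    by (auto intro!: derivative_eq_intros)
  moreover have "1 / (sqrt 2 * edge_norm c) * 2 = sqrt 2 / edge_norm c"
    using edge_norm_pos[of c] by (simp add: field_simps)
  ultimately show ?thesis
    by (intro DERIV_cong[OF DERIV_chain2[OF arsinh_real_has_field_derivative]]) auto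
qed

text \<open>Differentiating \<open>edge_arsinh\<close> gives a multiple of
  \<open>c / (chord_quad c * edge_norm c)\<close>. This function supplies the numerator
  \<open>1 - c\<close>, so all linear numerators over that denominator are covered.\<close>

lemma DERIV_arctan_edge_norm: "((\<lambda>c. arctan (c / edge_norm c)) has_real_derivative (1 - c) / (chord_quad c * edge_norm c)) (at c)"
proof -
  have R: "edge_norm c > 0" "(edge_norm c)\<^sup>2 = edge_quad c" by (rule edge_norm_pos edge_norm_power2)+
  have "((\<lambda>c. c / edge_norm c) has_real_derivative (1 - c) / edge_norm c ^ 3) (at c)"
  proof (rule DERIV_cong[OF DERIV_divide[OF DERIV_ident DERIV_edge_norm]])
    have "edge_norm c * edge_norm c - c * (2 * c - 1) = 1 - c"
      using R(2) by (simp add: power2_eq_square edge_quad_def algebra_simps)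
    then show "(1 * edge_norm c - c * ((2 * c - 1) / edge_norm c)) / (edge_norm c * edge_norm c) = (1 - c) / edge_norm c ^ 3"
      using R(1) by (simp add: field_simps power3_eq_cube)
  qed (use R in simp)
  then have "((\<lambda>c. arctan (c / edge_norm c)) has_real_derivative inverse (1 + (c / edge_norm c)\<^sup>2) * ((1 - c) / edge_norm c ^ 3)) (at c)"
    by (rule DERIV_chain2[OF DERIV_arctan])
  moreover have "inverse (1 + (c / edge_norm c)\<^sup>2) * ((1 - c) / edge_norm c ^ 3) = (1 - c) / (chord_quad c * edge_norm c)"
  proof -
    have h: "1 + (c / edge_norm c)\<^sup>2 = chord_quad c / (edge_norm c)\<^sup>2"
      using R edge_quad_pos[of c] by (simp add: power_divide field_simps chord_quad_eq)
    show ?thesis unfolding h using R(1) chord_quad_pos[of c] by (simp add: field_simps power2_eq_square power3_eq_cube)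
  qed
  ultimately show ?thesis by simp
qed

text \<open>Integrating a polynomial multiple of \<open>edge_arsinh\<close> by parts leaves terms that only these four
  functions can contribute; comparing coefficients in the polynomial identity \<open>eq\<close> determines \<open>p\<close>,
  the constant term of \<open>P\<close>, \<open>k\<close> and \<open>l\<close>.\<close>

lemma DERIV_elementary:
  assumes "(p has_real_derivative p') (at c)" and "(P has_real_derivative V) (at c)"
    and eq: "p' * edge_quad c * chord_quad c + p c * (2 * c - 1) * chord_quad c - 2 * P c * c + k * chord_quad c + l * (1 - c) = U * edge_quad c * chord_quad c"
  shows "((\<lambda>c. p c * edge_norm c + sqrt 2 * P c * edge_arsinh c + k / sqrt 2 * arsinh (2 * c - 1) + l * arctan (c / edge_norm c))
    has_real_derivative U * edge_norm c + sqrt 2 * V * edge_arsinh c) (at c)"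
proof -
  have R: "edge_norm c > 0" "(edge_norm c)\<^sup>2 = edge_quad c" "chord_quad c > 0" by (rule edge_norm_pos edge_norm_power2 chord_quad_pos)+
  \<comment> \<open>The identity \<open>eq\<close> is divided by
    \<open>chord_quad c * edge_norm c\<close>.\<close>
  have "U * edge_norm c = (U * edge_quad c * chord_quad c) / (chord_quad c * edge_norm c)"
    using R by (simp add: R(2)[symmetric] field_simps power2_eq_square)
  also have "\<dots> = p' * edge_norm c + p c * ((2 * c - 1) / edge_norm c) - 2 * P c * c / (chord_quad c * edge_norm c)
      + k / edge_norm c + l * ((1 - c) / (chord_quad c * edge_norm c))"
    unfolding eq[symmetric] using R by (simp add: R(2)[symmetric] field_simps power2_eq_square)
  finally have "p' * edge_norm c + p c * ((2 * c - 1) / edge_norm c)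
      + (sqrt 2 * V * edge_arsinh c + sqrt 2 * P c * (- (sqrt 2 * c) / (chord_quad c * edge_norm c)))
      + k / sqrt 2 * (sqrt 2 / edge_norm c) + l * ((1 - c) / (chord_quad c * edge_norm c)) = U * edge_norm c + sqrt 2 * V * edge_arsinh c"
    using R by (simp add: field_simps)
  then show ?thesis
    by (intro DERIV_cong[OF DERIV_add[OF DERIV_add[OF DERIV_add[OF
      DERIV_mult[OF assms(1) DERIV_edge_norm] DERIV_mult[OF DERIV_cmult[OF assms(2)] DERIV_edge_arsinh]]
      DERIV_cmult[OF DERIV_arsinh_edge_norm]] DERIV_cmult[OF DERIV_arctan_edge_norm]]]) (simp add: algebra_simps)
qed


text \<open>With \<open>D = chord_quad c\<close>, \<open>w = 1 - c\<close> and
  \<open>n = a - b = 2 * a - w\<close>, this integrates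
  \<open>|p| * (\<alpha> + \<beta> * |p|^2)\<close> along a line \<open>c = const\<close> of the
  triangle. The antiderivative is odd in \<open>n\<close>, so the two ends combine.\<close>

lemma integral_sqrt_quadratic:
  fixes D w \<alpha> \<beta> :: real
  assumes D: "D > 0" and w: "w \<ge> 0"
  defines "r \<equiv> \<lambda>n. sqrt ((D + n\<^sup>2) / 2)"
  shows "(\<integral>a. (r (2 * a - w) * (\<alpha> + \<beta> * (r (2 * a - w))\<^sup>2)) * indicator {0..w} a \<partial>lborel)
    = 1/2 * ((\<alpha> * w + \<beta> * (w * (D + w\<^sup>2) / 4 + 3/8 * D * w)) * r w
        + sqrt 2 * (\<alpha> * D / 2 + 3/16 * \<beta> * D\<^sup>2) * arsinh (w / sqrt D))"
proof -
  \<comment> \<open>Solved from the derivatives \<open>2 * r - D / (2 * r)\<close> of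
    \<open>n * r\<close> and \<open>4 * r^3 - 3/2 * D * r\<close> of \<open>n * r^3\<close>; the
    leftover \<open>1 / r\<close> integrates to arsinh.\<close>
  define H where "H = (\<lambda>n. \<alpha> * (n * r n / 2 + sqrt 2 * D / 4 * arsinh (n / sqrt D))
    + \<beta> * (n * r n ^ 3 / 4 + 3/16 * D * (n * r n) + 3/32 * sqrt 2 * D\<^sup>2 * arsinh (n / sqrt D)))"
  have pos: "D + n\<^sup>2 > 0" for n using D by (simp add: add_pos_nonneg)
  then have r: "r n > 0" "(r n)\<^sup>2 = (D + n\<^sup>2) / 2" for n
    using pos[of n] less_imp_le[OF pos[of n]] by (auto simp: r_def)
  have sq: "sqrt (D + n\<^sup>2) = sqrt 2 * r n" for n
    by (simp add: r_def real_sqrt_divide)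
  have dr: "(r has_real_derivative n / (2 * r n)) (at n)" for n
    unfolding r_def using pos[of n]
    by (auto intro!: derivative_eq_intros simp: field_simps real_sqrt_divide)
  have dH: "(H has_real_derivative r n * (\<alpha> + \<beta> * (r n)\<^sup>2)) (at n)" for n
  proof -
    have n2: "n\<^sup>2 = 2 * (r n)\<^sup>2 - D" using r(2)[of n] by simp
    have da: "((\<lambda>n. arsinh (n / sqrt D)) has_real_derivative 1 / (sqrt 2 * r n)) (at n)"
      using DERIV_arsinh_div_sqrt[OF D, of n] by (simp only: sq)
    have d1: "((\<lambda>n. n * r n) has_real_derivative 2 * r n - D / (2 * r n)) (at n)"
    proof (rule DERIV_cong[OF DERIV_mult[OF DERIV_ident dr]])
      have "n / (2 * r n) * n = (2 * (r n)\<^sup>2 - D) / (2 * r n)"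
        unfolding n2[symmetric] by (simp add: power2_eq_square)
      also have "\<dots> = r n - D / (2 * r n)" using r(1)[of n] by (simp add: field_simps power2_eq_square)
      finally show "1 * r n + n / (2 * r n) * n = 2 * r n - D / (2 * r n)" by simp
    qed
    have d3: "((\<lambda>n. n * r n ^ 3) has_real_derivative 4 * r n ^ 3 - 3/2 * D * r n) (at n)"
    proof (rule DERIV_cong[OF DERIV_mult[OF DERIV_ident DERIV_power[OF dr]]])
      have "real 3 * (n / (2 * r n) * r n ^ (3 - Suc 0)) * n = 3/2 * r n * n\<^sup>2"
        using r(1)[of n] by (simp add: field_simps power2_eq_square)
      then show "1 * r n ^ 3 + real 3 * (n / (2 * r n) * r n ^ (3 - Suc 0)) * n = 4 * r n ^ 3 - 3/2 * D * r n"
        unfolding n2 by (simp add: algebra_simps power2_eq_square power3_eq_cube)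
    qed
    have "(H has_real_derivative \<alpha> * ((2 * r n - D / (2 * r n)) / 2 + sqrt 2 * D / 4 * (1 / (sqrt 2 * r n)))
      + \<beta> * ((4 * r n ^ 3 - 3/2 * D * r n) / 4 + 3/16 * D * (2 * r n - D / (2 * r n))
         + 3/32 * sqrt 2 * D\<^sup>2 * (1 / (sqrt 2 * r n)))) (at n)"
      unfolding H_def
      by (intro DERIV_add DERIV_cmult DERIV_cdivide d1 d3 da)
    moreover have "\<alpha> * ((2 * r n - D / (2 * r n)) / 2 + sqrt 2 * D / 4 * (1 / (sqrt 2 * r n)))
      + \<beta> * ((4 * r n ^ 3 - 3/2 * D * r n) / 4 + 3/16 * D * (2 * r n - D / (2 * r n))
         + 3/32 * sqrt 2 * D\<^sup>2 * (1 / (sqrt 2 * r n))) = r n * (\<alpha> + \<beta> * (r n)\<^sup>2)"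
    proof -
      have "sqrt 2 * D / 4 * (1 / (sqrt 2 * r n)) = D / (4 * r n)"
        "3/32 * sqrt 2 * D\<^sup>2 * (1 / (sqrt 2 * r n)) = 3/32 * D\<^sup>2 / r n" by (simp_all add: field_simps)
      then show ?thesis
        using r(1)[of n] by (simp only:) (simp add: field_simps power2_eq_square power3_eq_cube)
    qed
    ultimately show ?thesis by simp
  qed
  have cr: "isCont r n" for n using dr DERIV_isCont by blast
  have "(\<integral>a. (r (2 * a - w) * (\<alpha> + \<beta> * (r (2 * a - w))\<^sup>2)) * indicator {0..w} a \<partial>lborel)
    = H (2 * w - w) / 2 - H (2 * 0 - w) / 2"
  proof (rule integral_FTC_Icc_real[OF w])
    fix a :: real
    have "((\<lambda>a. 2 * a - w) has_real_derivative 2) (at a)" by (auto intro!: derivative_eq_intros)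
    from DERIV_cdivide[OF DERIV_chain2[OF dH this], of 2]
    show "((\<lambda>a. H (2 * a - w) / 2) has_real_derivative r (2 * a - w) * (\<alpha> + \<beta> * (r (2 * a - w))\<^sup>2)) (at a)"
      by simp
    show "isCont (\<lambda>a. r (2 * a - w) * (\<alpha> + \<beta> * (r (2 * a - w))\<^sup>2)) a"
      by (intro continuous_intros isCont_o2[OF _ cr])
  qed
  also have "\<dots> = H w"
  proof -
    have "r (- w) = r w" by (simp add: r_def)
    then have "H (- w) = - H w" by (simp add: H_def algebra_simps)
    then show ?thesis by simp
  qed
  also have "r w ^ 3 = (D + w\<^sup>2) / 2 * r w"
    using r(2)[of w] by (simp add: power3_eq_cube power2_eq_square)
  then have "H w = 1/2 * ((\<alpha> * w + \<beta> * (w * (D + w\<^sup>2) / 4 + 3/8 * D * w)) * r w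
        + sqrt 2 * (\<alpha> * D / 2 + 3/16 * \<beta> * D\<^sup>2) * arsinh (w / sqrt D))"
    unfolding H_def by (simp only:) (simp add: field_simps)
  finally show ?thesis .
qed

text \<open>\<open>arsinh 1\<close> and \<open>arsinh (1 / sqrt 3)\<close> are the values of
  \<open>edge_arsinh\<close> at 0 and 1/2. The quotient inside \<open>arccoth (sqrt 2)\<close> is
  the square of \<open>1 + sqrt 2\<close>, hence the same logarithm.\<close>

lemma arsinh_values:
  "arsinh (1 :: real) = ln (1 + sqrt 2)" "arccoth (sqrt 2) = ln (1 + sqrt 2)"
  "arsinh (1 / sqrt 3 :: real) = ln 3 / 2"
proof -
  show "arsinh (1 :: real) = ln (1 + sqrt 2)" by (simp add: arsinh_real_def)
  have "(sqrt 2 + 1) / (sqrt 2 - 1) = (1 + sqrt 2)\<^sup>2"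
  proof -
    have "(1 + sqrt 2)\<^sup>2 * (sqrt 2 - 1) = sqrt 2 + 1"
      by (simp add: power2_eq_square algebra_simps)
    moreover have "sqrt 2 - 1 \<noteq> (0 :: real)" by simp
    ultimately show ?thesis by (simp add: divide_eq_eq)
  qed
  then show "arccoth (sqrt 2) = ln (1 + sqrt 2)"
    by (simp add: arccoth_def ln_realpow add_pos_pos)
  have "1 / sqrt 3 + sqrt ((1 / sqrt 3)\<^sup>2 + 1) = sqrt 3"
  proof -
    have "sqrt ((1 / sqrt 3)\<^sup>2 + 1) = sqrt (4 / 3)" by (simp add: power_divide)
    also have "\<dots> = 2 / sqrt 3" by (simp add: real_sqrt_divide)
    finally show ?thesis by (simp add: real_div_sqrt)
  qed
  then show "arsinh (1 / sqrt 3 :: real) = ln 3 / 2"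
    by (simp add: arsinh_real_def ln_sqrt)
qed


text \<open>The contribution of a corner term of \<open>octa_poly\<close> to the radial integral over \<open>0 \<le> t \<le> 2\<close>.\<close>

definition kappa :: "real \<Rightarrow> real" where
  "kappa x = 16 / 105 * max 0 (2 * x - 1) * (5 * max 0 (2 * x - 1) - 2)"

text \<open>The factor 9/2 is \<open>8 * (3/4)^2\<close>, from eight octants and the density 3/4 of
  each point. The term \<open>3 * kappa c\<close> stands for all three corners.\<close>

lemma integral_kappa:
  defines "r \<equiv> \<lambda>a c. sqrt (a\<^sup>2 + (1 - a - c)\<^sup>2 + c\<^sup>2)"
  shows "9/2 * (\<integral>c. (\<integral>a. (r a c * (128/105 - 32/21 * (r a c)\<^sup>2 + 3 * kappa c)) * indicator {0..1 - c} a \<partial>lborel)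
      * indicator {0..1} c \<partial>lborel)
    = 4 / 105 + 13 * sqrt 2 / 105 - 4 * pi / 45 + 109 * ln 3 / (630 * sqrt 2)
             + 16 * arccot (sqrt 2) / 315 + 158 * sqrt 2 * arccoth (sqrt 2) / 315"
proof -
  \<comment> \<open>Coefficients of \<open>edge_norm c\<close> and
    \<open>sqrt 2 * edge_arsinh c\<close> in \<open>integral_sqrt_quadratic\<close> for
    \<open>w = 1 - c\<close>, apart from its factor 1/2.\<close>
  define U where "U = (\<lambda>\<alpha> \<beta> c. \<alpha> * (1 - c) + \<beta> * ((1 - c) * edge_quad c / 2 + 3/8 * chord_quad c * (1 - c)))"
  define V where "V = (\<lambda>\<alpha> \<beta> c. \<alpha> * chord_quad c / 2 + 3/16 * \<beta> * (chord_quad c)\<^sup>2)"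
  \<comment> \<open>\<open>P1\<close> and \<open>P2\<close> are antiderivatives of the respective
    \<open>V\<close>. Their constant terms, \<open>p1\<close>, \<open>p2\<close> and the
    coefficients of arsinh and arctan below solve the linear equations contained in
    \<open>eq\<close> of \<open>DERIV_elementary\<close>.\<close>
  define p1 where "p1 = (\<lambda>c::real. - 2/35 - 16/35 * c + 94/35 * c^2 - 18/5 * c^3 + 51/35 * c^4)"
  define P1 where "P1 = (\<lambda>c::real. - 47/210 + 51/70 * c - 3/35 * c^2 - 27/35 * c^3 + 27/14 * c^4 - 81/70 * c^5)"
  define p2 where "p2 = (\<lambda>c::real. - 143/105 + 218/35 * c - 92/7 * c^2 + 432/35 * c^3 - 144/35 * c^4)"
  define P2 where "P2 = (\<lambda>c::real. - 46/63 + 18/5 * c - 342/35 * c^2 + 534/35 * c^3 - 72/5 * c^4 + 216/35 * c^5)"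
  define F1 where "F1 = (\<lambda>c. p1 c * edge_norm c + sqrt 2 * P1 c * edge_arsinh c + (47/105) / sqrt 2 * arsinh (2 * c - 1) + (- 32/105) * arctan (c / edge_norm c))"
  define F2 where "F2 = (\<lambda>c. p2 c * edge_norm c + sqrt 2 * P2 c * edge_arsinh c + (- 107/315) / sqrt 2 * arsinh (2 * c - 1) + (- 16/315) * arctan (c / edge_norm c))"
  \<comment> \<open>This is \<open>27/4 * kappa c\<close> for \<open>c \<ge> 1/2\<close>, with 27/4
    = 3 * 9/4. Likewise 96/35 and 24/7 are 9/4 times 128/105 and 32/21.\<close>
  define \<alpha> where "\<alpha> = (\<lambda>c::real. 36/35 * (2 * c - 1) * (5 * (2 * c - 1) - 2))"
  define f1 where "f1 = (\<lambda>c. U (96/35) (- 24/7) c * edge_norm c + sqrt 2 * V (96/35) (- 24/7) c * edge_arsinh c)"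
  define f2 where "f2 = (\<lambda>c. U (\<alpha> c) 0 c * edge_norm c + sqrt 2 * V (\<alpha> c) 0 c * edge_arsinh c)"
  have dp: "(p1 has_real_derivative - 16/35 + 188/35 * c - 54/5 * c^2 + 204/35 * c^3) (at c)"
    "(P1 has_real_derivative V (96/35) (- 24/7) c) (at c)"
    "(p2 has_real_derivative 218/35 - 184/7 * c + 1296/35 * c^2 - 576/35 * c^3) (at c)"
    "(P2 has_real_derivative V (\<alpha> c) 0 c) (at c)" for c
    unfolding p1_def P1_def p2_def P2_def V_def chord_quad_def \<alpha>_def
    by (auto intro!: derivative_eq_intros simp: algebra_simps add_divide_distrib diff_divide_distrib eval_nat_numeral)
  have d1: "(F1 has_real_derivative f1 c) (at c)" for c
    unfolding F1_def f1_def
    by (rule DERIV_elementary[OF dp(1,2)])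
       (simp add: p1_def P1_def U_def edge_quad_def chord_quad_def algebra_simps add_divide_distrib diff_divide_distrib eval_nat_numeral)
  have d2: "(F2 has_real_derivative f2 c) (at c)" for c
    unfolding F2_def f2_def
    by (rule DERIV_elementary[OF dp(3,4)])
       (simp add: p2_def P2_def U_def edge_quad_def chord_quad_def \<alpha>_def algebra_simps add_divide_distrib diff_divide_distrib eval_nat_numeral)
  have cont: "isCont f1 c" "isCont f2 c" for c
  proof -
    have "isCont edge_norm c" "isCont edge_arsinh c" using DERIV_edge_norm DERIV_edge_arsinh DERIV_isCont by blast+
    then show "isCont f1 c" "isCont f2 c"
      unfolding f1_def f2_def U_def V_def edge_quad_def chord_quad_def \<alpha>_def by (auto intro!: continuous_intros)
  qed
  have inner: "9/2 * (\<integral>a. (r a c * (128/105 - 32/21 * (r a c)\<^sup>2 + 3 * kappa c)) * indicator {0..1 - c} a \<partial>lborel)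
      = f1 c + f2 c * indicator {1/2..1} c" if c: "c \<in> {0..1}" for c
  proof -
    have r: "r a c = sqrt ((chord_quad c + (2 * a - (1 - c))\<^sup>2) / 2)" for a
      unfolding r_def chord_quad_def by (rule arg_cong[of _ _ sqrt]) (simp add: power2_eq_square field_simps)
    have q: "chord_quad c + (1 - c)\<^sup>2 = 2 * edge_quad c" by (simp add: chord_quad_def edge_quad_def power2_eq_square algebra_simps)
    have "(\<integral>a. (r a c * (128/105 - 32/21 * (r a c)\<^sup>2 + 3 * kappa c)) * indicator {0..1 - c} a \<partial>lborel)
      = (\<integral>a. (r a c * ((128/105 + 3 * kappa c) + (- 32/21) * (r a c)\<^sup>2)) * indicator {0..1 - c} a \<partial>lborel)"
      by (simp add: algebra_simps)
    also have "\<dots> = 1/2 * (U (128/105 + 3 * kappa c) (- 32/21) c * edge_norm c + sqrt 2 * V (128/105 + 3 * kappa c) (- 32/21) c * edge_arsinh c)"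
      unfolding r using integral_sqrt_quadratic[OF chord_quad_pos[of c], of "1 - c" "128/105 + 3 * kappa c" "- 32/21"] c
      by (simp only: q) (simp add: U_def V_def edge_norm_def edge_arsinh_def mult_ac)
    also have "9/2 * \<dots> = f1 c + (U (27/4 * kappa c) 0 c * edge_norm c + sqrt 2 * V (27/4 * kappa c) 0 c * edge_arsinh c)"
      unfolding f1_def U_def V_def by (simp add: field_simps)
    also have "27/4 * kappa c = \<alpha> c * indicator {1/2..1} c"
      using c by (auto simp: kappa_def \<alpha>_def max_def algebra_simps add_divide_distrib diff_divide_distrib split: split_indicator)
    finally show ?thesis by (auto simp: f2_def U_def V_def split: split_indicator)
  qed
  have "9/2 * (\<integral>c. (\<integral>a. (r a c * (128/105 - 32/21 * (r a c)\<^sup>2 + 3 * kappa c)) * indicator {0..1 - c} a \<partial>lborel)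
      * indicator {0..1} c \<partial>lborel)
    = (\<integral>c. f1 c * indicator {0..1} c + f2 c * indicator {1/2..1} c \<partial>lborel)"
    unfolding integral_mult_right_zero[symmetric]
    by (intro Bochner_Integration.integral_cong refl)
       (use inner in \<open>auto simp: mult.assoc[symmetric] split: split_indicator\<close>)
  \<comment> \<open>\<open>kappa\<close> vanishes below 1/2, so the corner part is integrated from
    there.\<close>
  also have "\<dots> = (F1 1 - F1 0) + (F2 1 - F2 (1/2))"
  proof -
    note h1 = has_bochner_integral_FTC_Icc_real[of 0 1 F1 f1, OF _ d1 cont(1)]
    note h2 = has_bochner_integral_FTC_Icc_real[of "1/2" 1 F2 f2, OF _ d2 cont(2)]
    show ?thesis using has_bochner_integral_add[OF h1 h2] by (simp add: has_bochner_integral_iff)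
  qed
  also have "\<dots> = 4 / 105 + 13 * sqrt 2 / 105 - 4 * pi / 45 + 109 * ln 3 / (630 * sqrt 2)
             + 16 * arccot (sqrt 2) / 315 + 158 * sqrt 2 * arccoth (sqrt 2) / 315"
  proof -
    have R: "edge_norm 0 = 1" "edge_norm 1 = 1" "edge_norm (1/2) = 1 / sqrt 2"
      by (simp_all add: edge_norm_def edge_quad_def power2_eq_square real_sqrt_divide)
    have h: "sqrt (chord_quad (1/2)) = sqrt 3 / 2"
      by (simp add: chord_quad_def power2_eq_square real_sqrt_divide)
    have "edge_arsinh (1/2) = ln 3 / 2" unfolding edge_arsinh_def h using arsinh_values(3) by simp
    moreover have "edge_arsinh 0 = ln (1 + sqrt 2)" "edge_arsinh 1 = 0"
      using arsinh_values by (simp_all add: edge_arsinh_def chord_quad_def)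
    ultimately have L: "edge_arsinh 0 = ln (1 + sqrt 2)" "edge_arsinh 1 = 0" "edge_arsinh (1/2) = ln 3 / 2" by auto
    have at: "arctan ((1/2) / (1 / sqrt 2)) = arccot (sqrt 2)"
      unfolding arccot_def by (rule arg_cong[of _ _ arctan]) (simp add: field_simps)
    have s: "sqrt 2 * sqrt 2 = (2::real)" by simp
    have "F1 1 = p1 1 + 47/105 / sqrt 2 * ln (1 + sqrt 2) - 32/105 * (pi / 4)"
      "F1 0 = p1 0 + sqrt 2 * P1 0 * ln (1 + sqrt 2) - 47/105 / sqrt 2 * ln (1 + sqrt 2)"
      "F2 1 = p2 1 - 107/315 / sqrt 2 * ln (1 + sqrt 2) - 16/315 * (pi / 4)"
      "F2 (1/2) = p2 (1/2) / sqrt 2 + sqrt 2 * P2 (1/2) * (ln 3 / 2) - 16/315 * arccot (sqrt 2)"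
      unfolding F1_def F2_def using at by (simp_all add: R L arsinh_values arctan_one)
    moreover have "p1 1 = 1/35" "p1 0 = - 2/35" "P1 0 = - 47/210" "p2 1 = - 1/21" "p2 (1/2) = - 26/105" "P2 (1/2) = - 109/630"
      by (simp_all add: p1_def P1_def p2_def P2_def eval_nat_numeral)
    moreover have d: "x / sqrt 2 = x * sqrt 2 / 2" for x :: real
      by (simp add: field_simps)
    moreover have "109 * ln 3 / (630 * sqrt 2) = 109 * ln 3 * sqrt 2 / 1260"
      by (simp add: field_simps)
    ultimately show ?thesis
      unfolding arsinh_values by (simp only: d) (simp add: algebra_simps)
  qed
  finally show ?thesis .
qed

section \<open>Reduction to the triangle\<close>

text \<open>At most one coordinate exceeds the sum of the others. For \<open>b \<le> a\<close> the
  three cases of \<open>overlap_integral\<close>, with \<open>m = a + b\<close> and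
  \<open>n = a - b\<close>, are the corner of \<open>c\<close>, no corner, and the corner of
  \<open>a\<close>; \<open>octa_poly\<close> unites them. The 2 offsets the 1/2 in
  \<open>covariogram_octahedron\<close>.\<close>

lemma octa_poly_overlap:
  assumes "0 \<le> c" "0 \<le> a" "0 \<le> b" "a + b + c \<le> 2"
  shows "((\<lambda>u. overlap c (a + b) u * overlap c \<bar>a - b\<bar> u) has_integral 2 * octa_poly c a b) {0..2 - max c (a + b)}"
proof -
  have *: "((\<lambda>u. overlap c (a + b) u * overlap c (a - b) u) has_integral 2 * octa_poly c a b) {0..2 - max c (a + b)}"
    if "0 \<le> b" "b \<le> a" "a + b + c \<le> 2" for a b
  proof (rule has_integral_eq_rhs[OF overlap_integral])
    show "2 * octa_poly c a b = (if a + b \<le> c then (2 - c - (a + b)) * ((a + b)\<^sup>2 / 2 + (2 - c - (a + b)) * (a + b) - (a - b)\<^sup>2 / 2 + (2 - c - (a + b))\<^sup>2 / 3)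
      else if a - b \<le> c then (2 - c - (a + b)) * (2 * c - 3/2 * c\<^sup>2 - (a - b)\<^sup>2 / 2) + (2 - c - (a + b))\<^sup>2 * (a + b - c) / 2 + (2 - c - (a + b)) ^ 3 / 3
      else (2 - c - (a + b)) * c * (2 - c - (a - b)) + (2 - c - (a + b))\<^sup>2 * (a + b - (a - b)) / 2 + (2 - c - (a + b)) ^ 3 / 3)"
    proof -
      have eb: "max 0 (2 * b - (a + b + c)) = 0" using that assms by simp
      consider "a + b \<le> c" | "\<not> a + b \<le> c" "a - b \<le> c" | "\<not> a - b \<le> c" "\<not> a + b \<le> c" using that by linarith
      then show ?thesis
      proof cases
        case 1
        then have "max 0 (2 * a - (a + b + c)) = 0" "max 0 (2 * c - (a + b + c)) = c - a - b" using that by simp_all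
        then show ?thesis unfolding octa_poly_def Let_def eb using 1
          by (simp add: algebra_simps add_divide_distrib diff_divide_distrib power2_eq_square power3_eq_cube)
      next
        case 2
        then have "max 0 (2 * a - (a + b + c)) = 0" "max 0 (2 * c - (a + b + c)) = 0" using that by simp_all
        then show ?thesis unfolding octa_poly_def Let_def eb using 2
          by (simp add: algebra_simps add_divide_distrib diff_divide_distrib power2_eq_square power3_eq_cube)
      next
        case 3
        then have "max 0 (2 * a - (a + b + c)) = a - b - c" "max 0 (2 * c - (a + b + c)) = 0" using that assms by simp_all
        then show ?thesis unfolding octa_poly_def Let_def eb using 3
          by (simp add: algebra_simps add_divide_distrib diff_divide_distrib power2_eq_square power3_eq_cube)
      qed
    qed
  qed (use that assms in auto)
  show ?thesis
  proof (cases "b \<le> a")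
    case True
    then show ?thesis using *[of b a] assms by simp
  next
    case False
    moreover have "octa_poly c b a = octa_poly c a b"
      unfolding octa_poly_def Let_def by (simp add: algebra_simps)
    ultimately show ?thesis using *[of a b] assms by (simp add: add.commute)
  qed
qed

text \<open>Nonnegativity is inherited from the integrand; it is not apparent from the
  polynomial.\<close>

lemma
  assumes "0 \<le> c" "0 \<le> a" "0 \<le> b" "a + b + c \<le> 2"
  shows octa_poly_nonneg: "octa_poly c a b \<ge> 0"
    and covariogram_octa_poly: "covariogram octahedron (vector [c, a, b]) = ennreal (octa_poly c a b)"
proof -
  let ?f = "\<lambda>u. overlap c (a + b) u * overlap c \<bar>a - b\<bar> u"
  let ?U = "2 - max c (a + b)"
  have ab: "\<bar>a - b\<bar> \<le> a + b" using assms by linarith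
  have nn: "overlap c (a + b) u \<ge> 0" "overlap c \<bar>a - b\<bar> u \<ge> 0" if "u \<in> {0..?U}" for u
    using that assms ab by (auto simp: overlap_def max_def split: if_splits)
  have I: "(?f has_integral 2 * octa_poly c a b) {0..?U}" by (rule octa_poly_overlap[OF assms])
  have "0 \<le> 2 * octa_poly c a b"
    by (rule has_integral_nonneg[OF I]) (use nn in auto)
  then show nonneg: "octa_poly c a b \<ge> 0" by simp
  have "(\<integral>\<^sup>+u. ennreal (overlap c (a + b) u) * ennreal (overlap c \<bar>a - b\<bar> u) * indicator {0..} u \<partial>lborel)
    = (\<integral>\<^sup>+u. ennreal (if u \<in> {0..?U} then ?f u else 0) \<partial>lborel)"
  proof (rule nn_integral_cong)
    fix u :: real
    \<comment> \<open>Beyond \<open>?U\<close> one factor is nonpositive and \<open>ennreal\<close>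
      sends it to 0, so the half-line reduces to the interval.\<close>
    have "overlap c (a + b) u \<le> 0" if "u \<ge> 0" "u > ?U"
      using that assms by (auto simp: overlap_def max_def split: if_splits)
    then have z: "ennreal (overlap c (a + b) u) = 0" if "u \<ge> 0" "u > ?U"
      using that by (simp add: ennreal_neg)
    show "ennreal (overlap c (a + b) u) * ennreal (overlap c \<bar>a - b\<bar> u) * indicator {0..} u
      = ennreal (if u \<in> {0..?U} then ?f u else 0)"
    proof (cases "u \<in> {0..?U}")
      case True
      then show ?thesis using nn[OF True] by (simp add: ennreal_mult)
    next
      case False
      then show ?thesis using z by (cases "u \<ge> 0") auto
    qed
  qed
  also have "\<dots> = ennreal (2 * octa_poly c a b)"
  proof (rule nn_integral_has_integral_lborel)
    show "((\<lambda>u. if u \<in> {0..?U} then ?f u else 0) has_integral 2 * octa_poly c a b) UNIV"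
      using I by (simp only: has_integral_restrict_UNIV)
    show "0 \<le> (if u \<in> {0..?U} then ?f u else 0)" for u using nn[of u] by simp
  qed measurable
  finally have "covariogram octahedron (vector [c, a, b]) = 1/2 * ennreal (2 * octa_poly c a b)"
    unfolding covariogram_octahedron using assms by simp
  also have "\<dots> = ennreal (octa_poly c a b)"
    using nonneg by (simp add: ennreal_mult mult.assoc[symmetric] ennreal_divide_times)
  finally show "covariogram octahedron (vector [c, a, b]) = ennreal (octa_poly c a b)" .
qed

text \<open>For larger sums the translates do not meet and \<open>octa_poly\<close> loses its
  meaning. Being real-valued, this form can be multiplied by the norm before passing to
  \<open>ennreal\<close>.\<close>

definition octa_cov :: "real \<Rightarrow> real \<Rightarrow> real \<Rightarrow> real" where
  "octa_cov c a b = (if \<bar>a\<bar> + \<bar>b\<bar> + \<bar>c\<bar> \<le> 2 then octa_poly \<bar>c\<bar> \<bar>a\<bar> \<bar>b\<bar> else 0)"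

lemma covariogram_octa_cov: "covariogram octahedron (vector [c, a, b]) = ennreal (octa_cov c a b)"
proof (cases "\<bar>a\<bar> + \<bar>b\<bar> + \<bar>c\<bar> \<le> 2")
  case True
  then show ?thesis
    using covariogram_octa_poly[of "\<bar>c\<bar>" "\<bar>a\<bar>" "\<bar>b\<bar>"]
    by (subst covariogram_octahedron_abs) (simp add: octa_cov_def)
next
  case False
  have "overlap \<bar>c\<bar> (\<bar>a\<bar> + \<bar>b\<bar>) u \<le> 0" for u
    using False unfolding overlap_def by linarith
  then have "ennreal (overlap \<bar>c\<bar> (\<bar>a\<bar> + \<bar>b\<bar>) u) = 0" for u
    by (simp add: ennreal_neg)
  then show ?thesis using False
    by (subst covariogram_octahedron_abs) (simp add: octa_cov_def covariogram_octahedron)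
qed

lemma emeasure_octahedron: "emeasure lborel octahedron = ennreal (4 / 3)"
proof -
  have "0 = (vector [0, 0, 0] :: real^3)" by (simp add: vec_eq_iff forall_3)
  then show ?thesis
    using covariogram_octa_cov[of 0 0 0] emeasure_covariogram[of octahedron]
    by (simp add: octa_cov_def octa_poly_def)
qed

lemma measurable_octa_cov [measurable (raw)]:
  assumes [measurable]: "f \<in> borel_measurable M" "g \<in> borel_measurable M" "h \<in> borel_measurable M"
  shows "(\<lambda>x. octa_cov (f x) (g x) (h x)) \<in> borel_measurable M"
  unfolding octa_cov_def octa_poly_def Let_def by measurable

lemma dist_integral_octahedron:
  "dist_integral octahedron = 8 * (\<integral>\<^sup>+c. \<integral>\<^sup>+a. \<integral>\<^sup>+b. ennreal (sqrt (a\<^sup>2 + b\<^sup>2 + c\<^sup>2) * octa_cov c a b)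
     * indicator {0..} b * indicator {0..} a * indicator {0..} c \<partial>lborel \<partial>lborel \<partial>lborel)"
proof -
  let ?f = "\<lambda>c a b. ennreal (sqrt (a\<^sup>2 + b\<^sup>2 + c\<^sup>2) * octa_cov c a b)"
  have n: "norm (vector [c, a, b] :: real^3) = sqrt (a\<^sup>2 + b\<^sup>2 + c\<^sup>2)" for a b c
    by (simp add: norm_vec_def L2_set_def sum_3 add_ac)
  have ev: "octa_cov (- c) a b = octa_cov c a b" "octa_cov c (- a) b = octa_cov c a b" "octa_cov c a (- b) = octa_cov c a b" for a b c
    by (simp_all add: octa_cov_def)
  have [measurable]: "covariogram octahedron \<in> borel_measurable borel"
    unfolding covariogram_def[abs_def] by measurable
  have "dist_integral octahedron = (\<integral>\<^sup>+z. ennreal (norm z) * covariogram octahedron z \<partial>lborel)"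
    by (rule dist_integral_covariogram) measurable
  also have "\<dots> = (\<integral>\<^sup>+c. \<integral>\<^sup>+a. \<integral>\<^sup>+b. ennreal (norm (vector [c, a, b] :: real^3)) * covariogram octahedron (vector [c, a, b]) \<partial>lborel \<partial>lborel \<partial>lborel)"
    by (rule nn_integral_vec3) measurable
  also have "\<dots> = (\<integral>\<^sup>+c. \<integral>\<^sup>+a. \<integral>\<^sup>+b. ?f c a b \<partial>lborel \<partial>lborel \<partial>lborel)"
    unfolding n covariogram_octa_cov by (simp add: ennreal_mult')
  also have "\<dots> = (\<integral>\<^sup>+c. \<integral>\<^sup>+a. 2 * (\<integral>\<^sup>+b. ?f c a b * indicator {0..} b \<partial>lborel) \<partial>lborel \<partial>lborel)"
    by (intro nn_integral_cong nn_integral_even) (auto simp: ev)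
  also have "\<dots> = (\<integral>\<^sup>+c. 2 * (\<integral>\<^sup>+a. 2 * (\<integral>\<^sup>+b. ?f c a b * indicator {0..} b \<partial>lborel) * indicator {0..} a \<partial>lborel) \<partial>lborel)"
    by (intro nn_integral_cong nn_integral_even) (auto simp: ev)
  also have "\<dots> = 2 * (\<integral>\<^sup>+c. 2 * (\<integral>\<^sup>+a. 2 * (\<integral>\<^sup>+b. ?f c a b * indicator {0..} b \<partial>lborel) * indicator {0..} a \<partial>lborel) * indicator {0..} c \<partial>lborel)"
    by (intro nn_integral_even) (auto simp: ev)
  also have "\<dots> = 2 * (2 * (2 * (\<integral>\<^sup>+c. (\<integral>\<^sup>+a. (\<integral>\<^sup>+b. ?f c a b * indicator {0..} b \<partial>lborel) * indicator {0..} a \<partial>lborel) * indicator {0..} c \<partial>lborel)))"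
    by (simp add: nn_integral_cmult mult.assoc)
  also have "\<dots> = 8 * (\<integral>\<^sup>+c. (\<integral>\<^sup>+a. (\<integral>\<^sup>+b. ?f c a b * indicator {0..} b \<partial>lborel) * indicator {0..} a \<partial>lborel) * indicator {0..} c \<partial>lborel)"
    by (simp add: mult.assoc[symmetric])
  also have "(\<integral>\<^sup>+c. (\<integral>\<^sup>+a. (\<integral>\<^sup>+b. ?f c a b * indicator {0..} b \<partial>lborel) * indicator {0..} a \<partial>lborel) * indicator {0..} c \<partial>lborel)
    = (\<integral>\<^sup>+c. \<integral>\<^sup>+a. \<integral>\<^sup>+b. ?f c a b * indicator {0..} b * indicator {0..} a * indicator {0..} c \<partial>lborel \<partial>lborel \<partial>lborel)"
    by (simp add: nn_integral_multc[symmetric])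
  finally show ?thesis .
qed

section \<open>From the octant to the triangle\<close>

lemma measurable_indicator_Icc [measurable (raw)]:
  fixes f g h :: "'a \<Rightarrow> real"
  assumes [measurable]: "f \<in> borel_measurable M" "g \<in> borel_measurable M" "h \<in> borel_measurable M"
  shows "(\<lambda>x. indicator {f x..g x} (h x) :: 'b :: {topological_space, zero_neq_one}) \<in> borel_measurable M"
  unfolding indicator_def atLeastAtMost_iff by measurable

text \<open>Serves the measurability prover, which meets \<open>F\<close> at the arguments created
  by substitutions.\<close>

lemma measurable_triple:
  assumes "(\<lambda>(x, y, z). F x y z) \<in> measurable (borel \<Otimes>\<^sub>M borel \<Otimes>\<^sub>M borel) N"
    and "f \<in> borel_measurable M" "g \<in> borel_measurable M" "h \<in> borel_measurable M"
  shows "(\<lambda>x. F (f x) (g x) (h x)) \<in> measurable M N"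
  using measurable_compose[OF measurable_Pair[OF assms(2) measurable_Pair[OF assms(3,4)]] assms(1)] by simp

text \<open>Substitute \<open>b = t - a - c\<close> and then scale \<open>a\<close> and \<open>c\<close> by \<open>t\<close>.\<close>

lemma nn_integral_octant_cone:
  fixes F :: "real \<Rightarrow> real \<Rightarrow> real \<Rightarrow> ennreal"
  assumes [measurable]: "(\<lambda>(c, a, b). F c a b) \<in> borel_measurable (borel \<Otimes>\<^sub>M borel \<Otimes>\<^sub>M borel)"
  shows "(\<integral>\<^sup>+c. \<integral>\<^sup>+a. \<integral>\<^sup>+b. F c a b * indicator {0..} b * indicator {0..} a * indicator {0..} c \<partial>lborel \<partial>lborel \<partial>lborel)
    = (\<integral>\<^sup>+c. \<integral>\<^sup>+a. (\<integral>\<^sup>+t. ennreal (t\<^sup>2) * F (t * c) (t * a) (t * (1 - a - c)) * indicator {0..} t \<partial>lborel)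
        * indicator {0..1 - c} a * indicator {0..1} c \<partial>lborel \<partial>lborel)"
proof -
  define H where "H = (\<lambda>c a t. F c a (t - a - c) * indicator {0..} (t - a - c) * indicator {0..} a * indicator {0..} c)"
  define T :: "real \<Rightarrow> real \<Rightarrow> ennreal" where "T = (\<lambda>c a. indicator {0..1 - c} a * indicator {0..1} c)"
  note [measurable (raw)] = measurable_triple[OF assms]
  have "(\<integral>\<^sup>+c. \<integral>\<^sup>+a. \<integral>\<^sup>+b. F c a b * indicator {0..} b * indicator {0..} a * indicator {0..} c \<partial>lborel \<partial>lborel \<partial>lborel)
    = (\<integral>\<^sup>+c. \<integral>\<^sup>+a. \<integral>\<^sup>+t. H c a t \<partial>lborel \<partial>lborel \<partial>lborel)"
  proof (rule nn_integral_cong, rule nn_integral_cong)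
    fix c a :: real
    show "(\<integral>\<^sup>+b. F c a b * indicator {0..} b * indicator {0..} a * indicator {0..} c \<partial>lborel) = (\<integral>\<^sup>+t. H c a t \<partial>lborel)"
      unfolding H_def
      by (subst nn_integral_real_affine[of _ 1 "- a - c"]) (auto intro!: nn_integral_cong simp: algebra_simps)
  qed
  also have "\<dots> = (\<integral>\<^sup>+c. \<integral>\<^sup>+t. \<integral>\<^sup>+a. H c a t \<partial>lborel \<partial>lborel \<partial>lborel)"
    unfolding H_def by (rule nn_integral_cong, rule lborel_pair.Fubini', measurable)
  also have "\<dots> = (\<integral>\<^sup>+t. \<integral>\<^sup>+c. \<integral>\<^sup>+a. H c a t \<partial>lborel \<partial>lborel \<partial>lborel)"
    unfolding H_def by (rule lborel_pair.Fubini', measurable)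
  also have "\<dots> = (\<integral>\<^sup>+t. \<integral>\<^sup>+c. \<integral>\<^sup>+a. ennreal (t\<^sup>2) * F (t * c) (t * a) (t * (1 - a - c)) * indicator {0..} t * T c a \<partial>lborel \<partial>lborel \<partial>lborel)"
  proof (rule nn_integral_cong_AE)
    \<comment> \<open>The scaling needs \<open>t > 0\<close>; for \<open>t < 0\<close> both sides
      are 0, and \<open>t = 0\<close> is a null set.\<close>
    show "AE t in lborel. (\<integral>\<^sup>+c. \<integral>\<^sup>+a. H c a t \<partial>lborel \<partial>lborel) =
      (\<integral>\<^sup>+c. \<integral>\<^sup>+a. ennreal (t\<^sup>2) * F (t * c) (t * a) (t * (1 - a - c)) * indicator {0..} t * T c a \<partial>lborel \<partial>lborel)"
      using AE_lborel_singleton[of "0::real"]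
    proof eventually_elim
      case (elim t)
      show ?case
      proof (cases "t > 0")
        case False
        with elim have "t < 0" by simp
        then have "H c a t = 0" for c a by (auto simp: H_def split: split_indicator)
        then show ?thesis using \<open>t < 0\<close> by simp
      next
        case True
        have HT: "H (t * c) (t * a) t = F (t * c) (t * a) (t * (1 - a - c)) * T c a" for c a
        proof -
          have "t - t * a - t * c = t * (1 - a - c)" by (simp add: algebra_simps)
          moreover have "0 \<le> t * c \<longleftrightarrow> 0 \<le> c" "0 \<le> t * a \<longleftrightarrow> 0 \<le> a" "0 \<le> t * (1 - a - c) \<longleftrightarrow> a + c \<le> 1"
            using True by (auto simp: zero_le_mult_iff)
          ultimately show ?thesis unfolding H_def T_def
            by (auto split: split_indicator)
        qed
        \<comment> \<open>Scaling \<open>c\<close> and then \<open>a\<close> gives one factor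
          \<open>t\<close> each, together \<open>t^2\<close>.\<close>
        have "(\<integral>\<^sup>+c. \<integral>\<^sup>+a. H c a t \<partial>lborel \<partial>lborel) = ennreal t * (\<integral>\<^sup>+c. \<integral>\<^sup>+a. H (t * c) a t \<partial>lborel \<partial>lborel)"
          using True unfolding H_def by (subst nn_integral_real_affine[of _ t 0]) auto
        also have "(\<integral>\<^sup>+c. \<integral>\<^sup>+a. H (t * c) a t \<partial>lborel \<partial>lborel) = (\<integral>\<^sup>+c. ennreal t * (\<integral>\<^sup>+a. H (t * c) (t * a) t \<partial>lborel) \<partial>lborel)"
          using True unfolding H_def by (intro nn_integral_cong, subst nn_integral_real_affine[of _ t 0]) auto
        also have "ennreal t * \<dots> = (\<integral>\<^sup>+c. ennreal (t\<^sup>2) * (\<integral>\<^sup>+a. F (t * c) (t * a) (t * (1 - a - c)) * T c a \<partial>lborel) \<partial>lborel)"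
        proof -
          define W where "W c = (\<integral>\<^sup>+a. F (t * c) (t * a) (t * (1 - a - c)) * T c a \<partial>lborel)" for c
          have [measurable]: "W \<in> borel_measurable lborel" unfolding W_def[abs_def] T_def by measurable
          show ?thesis unfolding HT W_def[symmetric] using True
            by (simp add: nn_integral_cmult power2_eq_square ennreal_mult mult.assoc)
        qed
        also have "\<dots> = (\<integral>\<^sup>+c. \<integral>\<^sup>+a. ennreal (t\<^sup>2) * F (t * c) (t * a) (t * (1 - a - c)) * indicator {0..} t * T c a \<partial>lborel \<partial>lborel)"
          unfolding T_def using True by (simp add: nn_integral_cmult mult.assoc)
        finally show ?thesis .
      qed
    qed
  qed
  also have "\<dots> = (\<integral>\<^sup>+c. \<integral>\<^sup>+t. \<integral>\<^sup>+a. ennreal (t\<^sup>2) * F (t * c) (t * a) (t * (1 - a - c)) * indicator {0..} t * T c a \<partial>lborel \<partial>lborel \<partial>lborel)"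
    unfolding T_def by (rule lborel_pair.Fubini', measurable)
  also have "\<dots> = (\<integral>\<^sup>+c. \<integral>\<^sup>+a. \<integral>\<^sup>+t. ennreal (t\<^sup>2) * F (t * c) (t * a) (t * (1 - a - c)) * indicator {0..} t * T c a \<partial>lborel \<partial>lborel \<partial>lborel)"
    unfolding T_def by (rule nn_integral_cong, rule lborel_pair.Fubini', measurable)
  also have "\<dots> = (\<integral>\<^sup>+c. \<integral>\<^sup>+a. (\<integral>\<^sup>+t. ennreal (t\<^sup>2) * F (t * c) (t * a) (t * (1 - a - c)) * indicator {0..} t \<partial>lborel) * T c a \<partial>lborel \<partial>lborel)"
    by (rule nn_integral_cong, rule nn_integral_cong, rule nn_integral_multc, measurable)
  finally show ?thesis unfolding T_def by (simp add: mult.assoc)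
qed

text \<open>The cone contributes \<open>t^2\<close> and the norm \<open>t * r\<close>, so
  \<open>t^3\<close> times the covariogram is integrated over \<open>[0, 2]\<close>. There
  \<open>t^5 * (2 - t) / 4\<close> has integral 16/21 and \<open>t^4 * (2 - t)^2 / 4\<close> has
  32/105, which gives the coefficients in \<open>J\<close> and \<open>kappa\<close>. The terms of
  \<open>J\<close> vary in sign; nonnegativity comes from the covariogram.\<close>

lemma nn_integral_radial:
  assumes "0 \<le> c" "0 \<le> a" "a + c \<le> 1"
  defines "b \<equiv> 1 - a - c"
  defines "r \<equiv> sqrt (a\<^sup>2 + b\<^sup>2 + c\<^sup>2)"
  defines "J \<equiv> 128/105 - 32/21 * r\<^sup>2 + kappa a + kappa b + kappa c"
  shows "(\<integral>\<^sup>+t. ennreal (t\<^sup>2) * ennreal (sqrt ((t * a)\<^sup>2 + (t * b)\<^sup>2 + (t * c)\<^sup>2) * octa_cov (t * c) (t * a) (t * b)) * indicator {0..} t \<partial>lborel)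
    = ennreal (r * J)" and "0 \<le> r * J"
proof -
  have b: "0 \<le> b" "a + b + c = 1" using assms by auto
  define e where "e = (\<lambda>x::real. max 0 (2 * x - 1))"
  define q where "q = 2 * (a * b + b * c + c * a) - (a\<^sup>2 + b\<^sup>2 + c\<^sup>2)"
  define E1 where "E1 = e a + e b + e c"
  define E2 where "E2 = (e a)\<^sup>2 + (e b)\<^sup>2 + (e c)\<^sup>2"
  \<comment> \<open>\<open>octa_poly\<close> along the ray: \<open>a + b + c = 1\<close> turns its
    \<open>s\<close> into \<open>2 - t\<close>, and its corner excesses are linear in
    \<open>t\<close>.\<close>
  define g where "g = (\<lambda>t. (2 - t) * ((2 - t) / 2 - (2 - t)\<^sup>2 / 12 + t\<^sup>2 * q / 4) + (2 - t) * t\<^sup>2 * E2 / 4 - (2 - t)\<^sup>2 * t * E1 / 4)"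
  define G where "G = (\<lambda>t. (t^4 - 4 * t^5 / 5 + t^6 / 6) / 2 - (2 * t^4 - 12 * t^5 / 5 + t^6 - t^7 / 7) / 12
      + (t^6 / 3 - t^7 / 7) * (q + E2) / 4 - (4 * t^5 / 5 - 2 * t^6 / 3 + t^7 / 7) * E1 / 4)"
  have poly: "octa_poly (t * c) (t * a) (t * b) = g t" if "t \<ge> 0" for t
  proof -
    have s: "t * a + t * b + t * c = t" using b(2) by (metis distrib_left mult.right_neutral)
    have "max 0 (2 * (t * x) - t) = t * e x" for x
      using that max_mult_distrib_left[of t 0 "2 * x - 1"] by (simp add: e_def algebra_simps)
    moreover have "2 - t * a - t * b - t * c = 2 - t" using s by simp
    ultimately show ?thesis
      unfolding octa_poly_def Let_def s g_def q_def E1_def E2_def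
      by (simp add: algebra_simps power2_eq_square add_divide_distrib diff_divide_distrib)
  qed
  have g0: "0 \<le> g t" if "t \<in> {0..2}" for t
    using octa_poly_nonneg[of "t * c" "t * a" "t * b"] poly[of t] that assms(1,2) b
    by (simp add: distrib_left[symmetric])
  have cov: "octa_cov (t * c) (t * a) (t * b) = g t * indicator {0..2} t" if "t \<ge> 0" for t
  proof -
    have "\<bar>t * a\<bar> + \<bar>t * b\<bar> + \<bar>t * c\<bar> = t"
      using that assms(1,2) b by (simp add: abs_mult distrib_left[symmetric])
    then show ?thesis using that assms(1,2) b poly[OF that]
      by (simp add: octa_cov_def indicator_def)
  qed
  have rt: "sqrt ((t * a)\<^sup>2 + (t * b)\<^sup>2 + (t * c)\<^sup>2) = t * r" if "t \<ge> 0" for t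
  proof -
    have "(t * a)\<^sup>2 + (t * b)\<^sup>2 + (t * c)\<^sup>2 = t\<^sup>2 * (a\<^sup>2 + b\<^sup>2 + c\<^sup>2)" by (simp add: power_mult_distrib algebra_simps)
    then show ?thesis using that by (simp add: r_def real_sqrt_mult)
  qed
  have r0: "r \<ge> 0" by (simp add: r_def add_nonneg_nonneg)
  have dG: "(G has_real_derivative t^3 * g t) (at t)" for t
    unfolding G_def g_def
    by (auto intro!: derivative_eq_intros simp: algebra_simps add_divide_distrib diff_divide_distrib eval_nat_numeral)
  have g3: "0 \<le> t^3 * g t" if "t \<in> {0..2}" for t using g0[OF that] that by simp
  have FTC: "(\<integral>\<^sup>+t. ennreal (t^3 * g t) * indicator {0..2} t \<partial>lborel) = ennreal (G 2 - G 0)"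
  proof (rule nn_integral_FTC_Icc)
    show "(\<lambda>t. t^3 * g t) \<in> borel_measurable borel" unfolding g_def by measurable
  qed (use dG g3 in auto)
  have "G 0 \<le> G 2"
    by (rule DERIV_nonneg_imp_nondecreasing) (use dG g3 in \<open>auto intro!: exI\<close>)
  have GJ: "G 2 - G 0 = J"
  proof -
    have q: "q = 1 - 2 * r\<^sup>2"
    proof -
      have "r\<^sup>2 = a\<^sup>2 + b\<^sup>2 + c\<^sup>2" by (simp add: r_def add_nonneg_nonneg)
      moreover have "(a + b + c)\<^sup>2 = 1" using b by simp
      ultimately show ?thesis by (simp add: q_def power2_eq_square algebra_simps)
    qed
    have k: "kappa x = 16/21 * (e x)\<^sup>2 - 32/105 * e x" for x
      by (simp add: kappa_def e_def power2_eq_square algebra_simps diff_divide_distrib)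
    show ?thesis unfolding J_def k G_def q E1_def E2_def by (simp add: field_simps)
  qed
  show "0 \<le> r * J"
    using r0 \<open>G 0 \<le> G 2\<close> by (simp flip: GJ)
  show "(\<integral>\<^sup>+t. ennreal (t\<^sup>2) * ennreal (sqrt ((t * a)\<^sup>2 + (t * b)\<^sup>2 + (t * c)\<^sup>2) * octa_cov (t * c) (t * a) (t * b)) * indicator {0..} t \<partial>lborel)
    = ennreal (r * J)"
  proof -
    have "ennreal (t\<^sup>2) * ennreal (sqrt ((t * a)\<^sup>2 + (t * b)\<^sup>2 + (t * c)\<^sup>2) * octa_cov (t * c) (t * a) (t * b)) * indicator {0..} t
      = ennreal r * (ennreal (t^3 * g t) * indicator {0..2} t)" for t
    proof (cases "t \<ge> 0")
      case True
      then show ?thesis unfolding rt[OF True] cov[OF True] using g0[of t] r0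
        by (auto simp: ennreal_mult[symmetric] power2_eq_square power3_eq_cube mult_ac split: split_indicator)
    qed auto
    then have "(\<integral>\<^sup>+t. ennreal (t\<^sup>2) * ennreal (sqrt ((t * a)\<^sup>2 + (t * b)\<^sup>2 + (t * c)\<^sup>2) * octa_cov (t * c) (t * a) (t * b)) * indicator {0..} t \<partial>lborel)
      = ennreal r * ennreal (G 2 - G 0)"
      unfolding FTC[symmetric] g_def by (simp add: nn_integral_cmult)
    then show ?thesis using GJ r0 by (simp add: ennreal_mult')
  qed
qed

section \<open>The mean distance\<close>

text \<open>By the symmetry of the triangle the three \<^const>\<open>kappa\<close> terms contribute equally.\<close>

lemma
  defines "W \<equiv> (\<integral>c. (\<integral>a. (sqrt (a\<^sup>2 + (1 - a - c)\<^sup>2 + c\<^sup>2)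
      * (128/105 - 32/21 * (sqrt (a\<^sup>2 + (1 - a - c)\<^sup>2 + c\<^sup>2))\<^sup>2 + 3 * kappa c))
      * indicator {0..1 - c} a \<partial>lborel) * indicator {0..1} c \<partial>lborel)"
  shows dist_integral_octahedron_eq: "dist_integral octahedron = ennreal (8 * W)"
    and simplex_integral_nonneg: "0 \<le> W"
proof -
  define r where "r c a = sqrt (a\<^sup>2 + (1 - a - c)\<^sup>2 + c\<^sup>2)" for c a :: real
  define T where "T = {(c, a). 0 \<le> c \<and> 0 \<le> a \<and> a + c \<le> (1 :: real)}"
  define g where "g c a = 128/105 - 32/21 * (r c a)\<^sup>2" for c a
  define f0 where "f0 c a = indicator T (c, a) * (r c a * g c a)" for c a
  define ka where "ka c a = indicator T (c, a) * (r c a * kappa a)" for c a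
  define kb where "kb c a = indicator T (c, a) * (r c a * kappa (1 - a - c))" for c a
  define kc where "kc c a = indicator T (c, a) * (r c a * kappa c)" for c a
  define h where "h c a = r c a * (g c a + kappa a + kappa (1 - a - c) + kappa c)" for c a
  let ?P = "lborel \<Otimes>\<^sub>M lborel :: (real \<times> real) measure"
  have T_prod: "indicator T (c, a) = (indicator {0..1 - c} a * indicator {0..1} c :: 'q :: comm_semiring_1)" for c a
    by (auto simp: T_def indicator_def)
  have "compact T"
  proof -
    have "closed T" unfolding T_def case_prod_unfold
      by (intro closed_Collect_conj closed_Collect_le continuous_intros)
    moreover have "T \<subseteq> cbox (0, 0) (1, 1)" by (auto simp: T_def)
    ultimately show ?thesis using bounded_cbox bounded_subset compact_eq_bounded_closed by blast
  qed
  \<comment> \<open>The summands change sign, so splitting the integral needs their integrability;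
    continuity on the compact triangle provides it.\<close>
  then have int: "integrable ?P (\<lambda>(c, a). indicator T (c, a) * q c a)" if "continuous_on T (\<lambda>(c, a). q c a)" for q :: "real \<Rightarrow> real \<Rightarrow> real"
    using borel_integrable_compact[OF _ that] by (simp add: lborel_prod case_prod_unfold)
  have "continuous_on T (\<lambda>(c, a). r c a * g c a)" "continuous_on T (\<lambda>(c, a). r c a * kappa a)"
    "continuous_on T (\<lambda>(c, a). r c a * kappa (1 - a - c))" "continuous_on T (\<lambda>(c, a). r c a * kappa c)"
    unfolding r_def g_def kappa_def case_prod_unfold by (intro continuous_intros)+
  from this[THEN int] have I: "integrable ?P (\<lambda>(c, a). f0 c a)" "integrable ?P (\<lambda>(c, a). ka c a)"
    "integrable ?P (\<lambda>(c, a). kb c a)" "integrable ?P (\<lambda>(c, a). kc c a)"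
    unfolding f0_def ka_def kb_def kc_def by auto
  have r_sym: "r c a = r a c" "r c (1 - c - a) = r c a" for a c
    unfolding r_def by (rule arg_cong[of _ _ sqrt], simp add: algebra_simps)+
  \<comment> \<open>The reflection exchanging \<open>a\<close> and \<open>c\<close>. The one below
    replaces \<open>a\<close> by \<open>1 - c - a\<close> at fixed \<open>c\<close>; both preserve
    \<open>r\<close>.\<close>
  have ka_swap: "ka c a = kc a c" for a c
    unfolding ka_def kc_def by (subst r_sym(1)) (auto simp: T_def indicator_def)
  have "(\<integral>p. (case p of (c, a) \<Rightarrow> ka c a) \<partial>?P) = (\<integral>a. \<integral>c. ka c a \<partial>lborel \<partial>lborel)"
    using lborel_pair.integral_snd[OF I(2)] by simp
  also have "\<dots> = (\<integral>p. (case p of (c, a) \<Rightarrow> kc c a) \<partial>?P)"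
    unfolding ka_swap using lborel_pair.integral_fst[OF I(4)] by simp
  finally have ka_kc: "(\<integral>p. (case p of (c, a) \<Rightarrow> ka c a) \<partial>?P) = (\<integral>p. (case p of (c, a) \<Rightarrow> kc c a) \<partial>?P)" .
  have "kb c ((1 - c) + (- 1) * a) = ka c a" for c a
    unfolding kb_def ka_def using r_sym(2)[of c a] by (auto simp: T_def indicator_def)
  then have inner: "(\<integral>a. kb c a \<partial>lborel) = (\<integral>a. ka c a \<partial>lborel)" for c
    by (subst lborel_integral_real_affine[of "- 1" _ "1 - c"]) auto
  have "(\<integral>p. (case p of (c, a) \<Rightarrow> kb c a) \<partial>?P) = (\<integral>c. \<integral>a. kb c a \<partial>lborel \<partial>lborel)"
    using lborel_pair.integral_fst[OF I(3)] by simp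
  also have "\<dots> = (\<integral>p. (case p of (c, a) \<Rightarrow> ka c a) \<partial>?P)"
    unfolding inner using lborel_pair.integral_fst[OF I(2)] by simp
  finally have kb_ka: "(\<integral>p. (case p of (c, a) \<Rightarrow> kb c a) \<partial>?P) = (\<integral>p. (case p of (c, a) \<Rightarrow> ka c a) \<partial>?P)" .
  have h_eq: "indicator T p * h (fst p) (snd p) = (case p of (c, a) \<Rightarrow> f0 c a) + (case p of (c, a) \<Rightarrow> ka c a)
      + (case p of (c, a) \<Rightarrow> kb c a) + (case p of (c, a) \<Rightarrow> kc c a)" for p
    by (cases p) (simp add: h_def f0_def ka_def kb_def kc_def algebra_simps)
  have Ih: "integrable ?P (\<lambda>p. indicator T p * h (fst p) (snd p))"
    unfolding h_eq using I by (intro Bochner_Integration.integrable_add) 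
  have Ifc: "integrable ?P (\<lambda>(c, a). f0 c a + 3 * kc c a)"
    using Bochner_Integration.integrable_add[OF I(1) integrable_mult_right[OF I(4), of 3]] by (simp add: case_prod_unfold)
  have "(\<integral>p. indicator T p * h (fst p) (snd p) \<partial>?P) = (\<integral>p. (case p of (c, a) \<Rightarrow> f0 c a) \<partial>?P) + 3 * (\<integral>p. (case p of (c, a) \<Rightarrow> kc c a) \<partial>?P)"
    unfolding h_eq using I by (simp add: ka_kc kb_ka)
  also have "\<dots> = (\<integral>p. (case p of (c, a) \<Rightarrow> f0 c a + 3 * kc c a) \<partial>?P)"
    using Bochner_Integration.integral_add[OF I(1) integrable_mult_right[OF I(4), of 3]] by (simp add: case_prod_unfold)
  also have "\<dots> = (\<integral>c. \<integral>a. f0 c a + 3 * kc c a \<partial>lborel \<partial>lborel)"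
    using lborel_pair.integral_fst[OF Ifc] by simp
  also have "\<dots> = W"
    unfolding W_def r_def[symmetric] g_def[symmetric]
  proof (rule Bochner_Integration.integral_cong[OF refl])
    fix c :: real
    have "f0 c a + 3 * kc c a = (r c a * (g c a + 3 * kappa c)) * indicator {0..1 - c} a * indicator {0..1} c" for a
      unfolding f0_def kc_def T_prod by (simp add: algebra_simps)
    then show "(\<integral>a. f0 c a + 3 * kc c a \<partial>lborel) = (\<integral>a. (r c a * (g c a + 3 * kappa c)) * indicator {0..1 - c} a \<partial>lborel) * indicator {0..1} c"
      by simp
  qed
  finally have W: "(\<integral>p. indicator T p * h (fst p) (snd p) \<partial>?P) = W" .
  \<comment> \<open>Permits the return to nonnegative integrals: the whole integrand is nonnegative
    although its summands are not.\<close>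
  have h0: "0 \<le> indicator T p * h (fst p) (snd p)" for p
    using nn_integral_radial(2)[of "fst p" "snd p"]
    by (auto simp: T_def h_def r_def g_def indicator_def case_prod_unfold)
  show "0 \<le> W" unfolding W[symmetric] by (rule Bochner_Integration.integral_nonneg) (rule h0)
  have mh [measurable]: "(\<lambda>p. indicator T p * h (fst p) (snd p)) \<in> borel_measurable ?P"
    using Ih by (rule borel_measurable_integrable)
  have "dist_integral octahedron = 8 * (\<integral>\<^sup>+c. \<integral>\<^sup>+a. (\<integral>\<^sup>+t. ennreal (t\<^sup>2) * ennreal (sqrt ((t * a)\<^sup>2 + (t * (1 - a - c))\<^sup>2 + (t * c)\<^sup>2)
      * octa_cov (t * c) (t * a) (t * (1 - a - c))) * indicator {0..} t \<partial>lborel)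
        * indicator {0..1 - c} a * indicator {0..1} c \<partial>lborel \<partial>lborel)"
    unfolding dist_integral_octahedron
  proof (subst nn_integral_octant_cone[of "\<lambda>c a b. ennreal (sqrt (a\<^sup>2 + b\<^sup>2 + c\<^sup>2) * octa_cov c a b)"])
    show "(\<lambda>(c, a, b). ennreal (sqrt (a\<^sup>2 + b\<^sup>2 + c\<^sup>2) * octa_cov c a b)) \<in> borel_measurable (borel \<Otimes>\<^sub>M borel \<Otimes>\<^sub>M borel)"
      by measurable
  qed (rule refl)
  also have "\<dots> = 8 * (\<integral>\<^sup>+c. \<integral>\<^sup>+a. ennreal (indicator T (c, a) * h c a) \<partial>lborel \<partial>lborel)"
  proof -
    have "(\<integral>\<^sup>+t. ennreal (t\<^sup>2) * ennreal (sqrt ((t * a)\<^sup>2 + (t * (1 - a - c))\<^sup>2 + (t * c)\<^sup>2)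
      * octa_cov (t * c) (t * a) (t * (1 - a - c))) * indicator {0..} t \<partial>lborel)
        * indicator {0..1 - c} a * indicator {0..1} c = ennreal (indicator T (c, a) * h c a)" for c a
    proof (cases "(c, a) \<in> T")
      case True
      then have ca: "0 \<le> c" "0 \<le> a" "a + c \<le> 1" by (auto simp: T_def)
      then show ?thesis using True nn_integral_radial(1)[OF ca]
        by (simp add: h_def r_def g_def indicator_def)
    next
      case False
      then show ?thesis by (auto simp: T_def indicator_def)
    qed
    then show ?thesis by simp
  qed
  also have "(\<integral>\<^sup>+c. \<integral>\<^sup>+a. ennreal (indicator T (c, a) * h c a) \<partial>lborel \<partial>lborel) = (\<integral>\<^sup>+p. ennreal (indicator T p * h (fst p) (snd p)) \<partial>?P)"
    using lborel.nn_integral_fst[of "\<lambda>p. ennreal (indicator T p * h (fst p) (snd p))" lborel] by simp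
  also have "\<dots> = ennreal W"
    unfolding W[symmetric] using h0 by (intro nn_integral_eq_integral[OF Ih]) auto
  finally show "dist_integral octahedron = ennreal (8 * W)"
    using \<open>0 \<le> W\<close> by (simp add: ennreal_mult)
qed

theorem mainTheorem3:
  fixes M :: "'w measure"
  assumes "prob_space M"
  shows
    "let m = 4 / 105 + 13 * sqrt 2 / 105 - 4 * pi / 45 + 109 * ln 3 / (630 * sqrt 2)
             + 16 * arccot (sqrt 2) / 315 + 158 * sqrt 2 * arccoth (sqrt 2) / 315
     in (\<forall>e. e edge_of octahedron \<longrightarrow> (\<exists>a b. e = closed_segment a b \<and> dist a b = sqrt 2)) \<and>
        measure lborel octahedron = 4 / 3 \<and>
        (\<forall>X Y. independent_uniform_pair M octahedron X Y \<longrightarrow>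
           prob_space.expectation M (\<lambda>w. norm (X w - Y w)) = m) \<and>
        (\<forall>L X Y. regular_octahedron L \<and> measure lborel L = 1 \<and> independent_uniform_pair M L X Y \<longrightarrow>
           prob_space.expectation M (\<lambda>w. norm (X w - Y w)) = root 3 (3 / 4) * m)"
proof -
  define m :: real where "m = 4 / 105 + 13 * sqrt 2 / 105 - 4 * pi / 45 + 109 * ln 3 / (630 * sqrt 2)
             + 16 * arccot (sqrt 2) / 315 + 158 * sqrt 2 * arccoth (sqrt 2) / 315"
  obtain W where W: "dist_integral octahedron = ennreal (8 * W)" "0 \<le> W" "9/2 * W = m"
    by (rule that[OF dist_integral_octahedron_eq simplex_integral_nonneg integral_kappa[folded m_def]])
  \<comment> \<open>\<open>8 * W = 16/9 * m\<close>, where 16/9 is the squared volume by which the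
    expectation is divided.\<close>
  have D: "dist_integral octahedron = ennreal (16/9 * m)" "0 \<le> m" using W by auto
  have vol: "measure lborel octahedron = 4 / 3" by (simp add: measure_def emeasure_octahedron)
  have "prob_space.expectation M (\<lambda>w. norm (X w - Y w)) = m"
    if "independent_uniform_pair M octahedron X Y" for X Y
    using expectation_dist_uniform[OF assms octahedron_borel _ _ that] D
    by (simp add: emeasure_octahedron vol power2_eq_square)
  moreover have "prob_space.expectation M (\<lambda>w. norm (X w - Y w)) = root 3 (3 / 4) * m"
    if L: "regular_octahedron L" and L1: "measure lborel L = 1" and XY: "independent_uniform_pair M L X Y" for L X Y
  proof -
    obtain c s f where s: "s > 0" and f: "orthogonal_transformation f" and L_eq: "L = (\<lambda>x. c + s *\<^sub>R f x) ` octahedron"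
      using L unfolding regular_octahedron_def by blast
    have "compact octahedron"
      unfolding octahedron_def by (intro finite_imp_compact_convex_hull) simp
    moreover have "continuous_on octahedron (\<lambda>x. c + s *\<^sub>R f x)"
      using f by (intro continuous_intros linear_continuous_on)
        (simp add: orthogonal_transformation_linear linear_linear)
    ultimately have "compact L" unfolding L_eq by (rule compact_continuous_image[rotated])
    then have Lb: "L \<in> sets borel" by (simp add: borel_compact)
    have e: "emeasure lborel L = ennreal (s ^ 3 * (4 / 3))"
      using emeasure_similarity[OF octahedron_borel s f Lb L_eq] s by (simp add: emeasure_octahedron ennreal_mult[symmetric])
    then have s3: "s ^ 3 = 3 / 4" using L1 s by (simp add: measure_def)
    have s_root: "s = root 3 (3 / 4)"
      using real_root_power_cancel[of 3 s] s unfolding s3 by simp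
    \<comment> \<open>This makes \<open>s ^ 7 * 16/9\<close> equal to \<open>s\<close>, while the
      squared volume of \<open>L\<close> is 1.\<close>
    have s7: "s ^ 7 = 9 / 16 * s"
    proof -
      have "s ^ 7 = s ^ 3 * s ^ 3 * s" by (simp add: eval_nat_numeral)
      then show ?thesis unfolding s3 by simp
    qed
    have "dist_integral L = ennreal (s * m)"
      using dist_integral_similarity[OF octahedron_borel s f Lb L_eq] s D
      by (simp add: ennreal_mult[symmetric] s7)
    then show ?thesis
      using expectation_dist_uniform[OF assms Lb _ _ XY] s D(2) by (simp add: e s3 L1 s_root[symmetric])
  qed
  ultimately show ?thesis
    unfolding Let_def m_def[symmetric] using vol edge_of_octahedron by blast
qed

end
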